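(* Let $K$ be an infinite field with $\mathrm{char}(K)\neq 2$ such that $K^{\times}/(K^{\times})^2$ is finite. Then $Q_1$ is a Cartan subgroup of $SL_2(K)$, and for every $\delta\in K^{\times}\setminus (K^{\times})^2$ and every $\mu\in GL_2(K)$ the group $Q_\delta^{\mu}=\mu^{-1}Q_\delta\mu$ is a Cartan subgroup of $SL_2(K)$. Moreover, every Cartan subgroup of $SL_2(K)$ is conjugate in $SL_2(K)$ either to $Q_1$ or to $Q_\delta^{\mu_i}$ for some $\delta$ in a fixed finite set of representatives of the non-trivial cosets of $(K^{\times})^2$ in $K^{\times}$ and some $\mu_i$ among finitely many elements $\mu_1,\dots,\mu_n\in GL_2(K)$ (depending on $\delta$) satisfying $\bigcup_{g\in GL_2(K)}Q_\delta^{g}=\bigcup_{i=1}^n\bigcup_{g\in SL_2(K)}Q_\delta^{\mu_i g}$. In particular, $SL_2(K)$ has only finitely many conjugacy classes of Cartan subgroups.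
   Context: A subgroup $C$ of a group $G$ is a Cartan subgroup (in the sense of Chevalley) if (1) $C$ is a maximal nilpotent subgroup of $G$, and (2) every subgroup $X$ of finite index in $C$ has finite index in its normalizer $N_G(X)$. Conjugation: $X^g=g^{-1}Xg$. Notation: $Q_1=\left\{\begin{pmatrix}a&0\\0&a^{-1}\end{pmatrix}: a\in K^{\times}\right\}$ and, for $\delta\in K^{\times}\setminus(K^{\times})^2$, $Q_\delta=\left\{\begin{pmatrix}a&b\\ b\delta&a\end{pmatrix}\in SL_2(K): a,b\in K,\ a^2-b^2\delta=1\right\}$. *)

theory Defs
  imports
    "HOL-Analysis.Determinants"
    "HOL-Algebra.Generated_Groups"
    "HOL-Algebra.Group_Action"
begin

section \<open>Nilpotent groups and Cartan subgroups\<close>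

primrec lower_central :: "('a, 'b) monoid_scheme \<Rightarrow> nat \<Rightarrow> 'a set" where
  "lower_central G 0 = carrier G"
| "lower_central G (Suc n) =
    generate G (\<Union>x\<in>lower_central G n. \<Union>y\<in>carrier G.
      {x \<otimes>\<^bsub>G\<^esub> y \<otimes>\<^bsub>G\<^esub> inv\<^bsub>G\<^esub> x \<otimes>\<^bsub>G\<^esub> inv\<^bsub>G\<^esub> y})"

definition nilpotent_group :: "('a, 'b) monoid_scheme \<Rightarrow> bool" where
  "nilpotent_group G \<longleftrightarrow> group G \<and> (\<exists>n. lower_central G n = {\<one>\<^bsub>G\<^esub>})"

definition nilpotent_subgroup :: "('a, 'b) monoid_scheme \<Rightarrow> 'a set \<Rightarrow> bool" where
  "nilpotent_subgroup G C \<longleftrightarrow> subgroup C G \<and> nilpotent_group (G\<lparr>carrier := C\<rparr>)"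

definition maximal_nilpotent_subgroup :: "('a, 'b) monoid_scheme \<Rightarrow> 'a set \<Rightarrow> bool" where
  "maximal_nilpotent_subgroup G C \<longleftrightarrow>
    nilpotent_subgroup G C \<and> (\<forall>D. nilpotent_subgroup G D \<and> C \<subseteq> D \<longrightarrow> D = C)"

definition finite_index :: "('a, 'b) monoid_scheme \<Rightarrow> 'a set \<Rightarrow> bool" where
  "finite_index G H \<longleftrightarrow> subgroup H G \<and> finite (rcosets\<^bsub>G\<^esub> H)"

definition cartan_subgroup :: "('a, 'b) monoid_scheme \<Rightarrow> 'a set \<Rightarrow> bool" where
  "cartan_subgroup G C \<longleftrightarrow>
    maximal_nilpotent_subgroup G C \<and>
    (\<forall>X. finite_index (G\<lparr>carrier := C\<rparr>) X \<longrightarrow> finite_index (G\<lparr>carrier := normalizer G X\<rparr>) X)"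

text \<open>Conjugation is on the right: \<open>X\<^sup>g = g\<^sup>-\<^sup>1 X g\<close>.\<close>

definition conj_set :: "('a, 'b) monoid_scheme \<Rightarrow> 'a set \<Rightarrow> 'a \<Rightarrow> 'a set" where
  "conj_set G X g = (\<lambda>x. inv\<^bsub>G\<^esub> g \<otimes>\<^bsub>G\<^esub> x \<otimes>\<^bsub>G\<^esub> g) ` X"

definition conj_class :: "('a, 'b) monoid_scheme \<Rightarrow> 'a set \<Rightarrow> 'a set set" where
  "conj_class G X = conj_set G X ` carrier G"


section \<open>The groups \<open>K\<^sup>\<times>\<close>, \<open>GL\<^sub>2(K)\<close> and \<open>SL\<^sub>2(K)\<close>\<close>

definition mult_group :: "'k::field monoid" where
  "mult_group = \<lparr>carrier = UNIV - {0}, mult = (*), one = 1\<rparr>"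

definition nonzero_squares :: "'k::field set" where
  "nonzero_squares = (\<lambda>x. x\<^sup>2) ` carrier mult_group"

definition nonsquare_reps :: "'k::field set \<Rightarrow> bool" where
  "nonsquare_reps R \<longleftrightarrow>
    R \<subseteq> carrier mult_group - nonzero_squares \<and>
    (\<forall>c \<in> carrier (mult_group Mod nonzero_squares) - {nonzero_squares}. \<exists>!\<delta>. \<delta> \<in> R \<inter> c)"

definition GL2 :: "('k::field^2^2) monoid" where
  "GL2 = \<lparr>carrier = {A. invertible A}, mult = (**), one = mat 1\<rparr>"

definition SL2 :: "('k::field^2^2) monoid" where
  "SL2 = \<lparr>carrier = {A. det A = 1}, mult = (**), one = mat 1\<rparr>"

definition mat2 :: "'k::field \<Rightarrow> 'k \<Rightarrow> 'k \<Rightarrow> 'k \<Rightarrow> 'k^2^2" where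
  "mat2 a b c d = vector [vector [a, b], vector [c, d]]"

definition Q1 :: "('k::field^2^2) set" where
  "Q1 = {mat2 a 0 0 (inverse a) | a. a \<noteq> 0}"

definition Q :: "'k::field \<Rightarrow> ('k^2^2) set" where
  "Q \<delta> = {mat2 a b (b * \<delta>) a | a b. mat2 a b (b * \<delta>) a \<in> carrier SL2 \<and> a\<^sup>2 - b\<^sup>2 * \<delta> = 1}"

text \<open>A finite set \<open>{\<mu>\<^sub>1, \<dots>, \<mu>\<^sub>n} \<subseteq> GL\<^sub>2(K)\<close> with
  \<open>\<Union>\<^bsub>g \<in> GL\<^sub>2(K)\<^esub> Q\<^sub>\<delta>\<^sup>g = \<Union>\<^sub>i \<Union>\<^bsub>g \<in> SL\<^sub>2(K)\<^esub> Q\<^sub>\<delta>\<^bsup>\<mu>\<^sub>i g\<^esup>\<close>.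
  The two unions are unions of subgroups, i.e. sets of matrices, not sets of subgroups.\<close>

definition conj_cover :: "'k::field \<Rightarrow> ('k^2^2) set \<Rightarrow> bool" where
  "conj_cover \<delta> M \<longleftrightarrow>
    finite M \<and> M \<subseteq> carrier GL2 \<and>
    (\<Union>g\<in>carrier GL2. conj_set GL2 (Q \<delta>) g) =
      (\<Union>\<mu>\<in>M. \<Union>g\<in>carrier SL2. conj_set GL2 (Q \<delta>) (\<mu> \<otimes>\<^bsub>GL2\<^esub> g))"


section \<open>Basic facts\<close>

lemma comm_group_mult_group: "comm_group (mult_group :: 'k::field monoid)"
proof (rule comm_groupI)
  fix x :: 'k assume "x \<in> carrier mult_group"
  then show "\<exists>y\<in>carrier mult_group. y \<otimes>\<^bsub>mult_group\<^esub> x = \<one>\<^bsub>mult_group\<^esub>"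
    by (intro bexI[of _ "inverse x"]) (auto simp: mult_group_def)
qed (auto simp: mult_group_def)

lemma subgroup_nonzero_squares: "subgroup nonzero_squares (mult_group :: 'k::field monoid)"
proof -
  interpret comm_group "mult_group :: 'k monoid" by (rule comm_group_mult_group)
  have inv: "inv\<^bsub>mult_group\<^esub> x = inverse x" if "x \<noteq> 0" for x :: 'k
    by (rule inv_equality) (use that in \<open>auto simp: mult_group_def\<close>)
  show ?thesis
  proof (rule subgroupI)
    show "nonzero_squares \<subseteq> carrier (mult_group :: 'k monoid)"
      by (auto simp: nonzero_squares_def mult_group_def)
    show "nonzero_squares \<noteq> ({} :: 'k set)"
      using one_closed by (auto simp: nonzero_squares_def)
  next
    fix a :: 'k assume "a \<in> nonzero_squares"
    then obtain x where x: "x \<noteq> 0" "a = x\<^sup>2"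
      by (auto simp: nonzero_squares_def mult_group_def)
    then have "inv\<^bsub>mult_group\<^esub> a = (inverse x)\<^sup>2"
      by (simp add: inv power_inverse)
    then show "inv\<^bsub>mult_group\<^esub> a \<in> nonzero_squares"
      using x by (auto simp: nonzero_squares_def mult_group_def)
  next
    fix a b :: 'k assume "a \<in> nonzero_squares" "b \<in> nonzero_squares"
    then obtain x y where "x \<noteq> 0" "a = x\<^sup>2" "y \<noteq> 0" "b = y\<^sup>2"
      by (auto simp: nonzero_squares_def mult_group_def)
    then show "a \<otimes>\<^bsub>mult_group\<^esub> b \<in> nonzero_squares"
      by (auto simp: nonzero_squares_def mult_group_def power_mult_distrib[symmetric])
  qed
qed

lemma group_GL2: "group (GL2 :: ('k::field^2^2) monoid)"
proof (rule groupI)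
  fix A :: "'k^2^2" assume "A \<in> carrier GL2"
  then obtain B where "A ** B = mat 1" "B ** A = mat 1"
    by (auto simp: GL2_def invertible_def)
  then show "\<exists>B\<in>carrier GL2. B \<otimes>\<^bsub>GL2\<^esub> A = \<one>\<^bsub>GL2\<^esub>"
    by (auto simp: GL2_def invertible_def)
qed (auto simp: GL2_def matrix_mul_assoc invertible_mult invertible_def[of "mat 1"])

lemma subgroup_SL2_GL2: "subgroup (carrier SL2) (GL2 :: ('k::field^2^2) monoid)"
proof -
  interpret group "GL2 :: ('k^2^2) monoid" by (rule group_GL2)
  show ?thesis
  proof (rule subgroupI)
    show "carrier SL2 \<subseteq> carrier (GL2 :: ('k^2^2) monoid)"
      by (auto simp: SL2_def GL2_def invertible_det_nz)
    show "carrier SL2 \<noteq> ({} :: ('k^2^2) set)"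
      by (auto simp: SL2_def intro: exI[of _ "mat 1"])
  next
    fix A :: "'k^2^2" assume A: "A \<in> carrier SL2"
    then have "A \<in> carrier GL2" by (auto simp: SL2_def GL2_def invertible_det_nz)
    then have "inv\<^bsub>GL2\<^esub> A ** A = mat 1" using l_inv[of A] by (simp add: GL2_def)
    then have "det (inv\<^bsub>GL2\<^esub> A) * det A = 1" by (metis det_mul det_I)
    then show "inv\<^bsub>GL2\<^esub> A \<in> carrier SL2" using A by (auto simp: SL2_def)
  next
    fix A B :: "'k^2^2" assume "A \<in> carrier SL2" "B \<in> carrier SL2"
    then show "A \<otimes>\<^bsub>GL2\<^esub> B \<in> carrier SL2" by (auto simp: SL2_def GL2_def det_mul)
  qed
qed

lemma SL2_eq: "SL2 = GL2\<lparr>carrier := carrier SL2\<rparr>"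
  by (simp add: SL2_def GL2_def)

lemma group_SL2: "group (SL2 :: ('k::field^2^2) monoid)"
  by (metis SL2_eq group.subgroup_imp_group group_GL2 subgroup_SL2_GL2)

end

theory Submission
  imports Defs "HOL-Algebra.Zassenhaus"
begin

text \<open>
  Every torus in the statement is the centraliser in \<open>SL\<^sub>2(K)\<close> of a matrix \<open>z\<close> with trace \<open>0\<close> and
  determinant \<open>\<noteq> 0\<close>, and commuting is transitive through non-scalar \<open>2 \<times> 2\<close> matrices.
  If \<open>D\<close> is an infinite nilpotent subgroup, the last term of its lower central series not contained
  in \<open>{\<plusminus>1}\<close> yields a non-scalar \<open>x \<in> D\<close> with \<open>x d = \<plusminus> d x\<close> for all \<open>d \<in> D\<close>. The minus sign is
  impossible: some \<open>w \<in> D\<close> would invert the centraliser of \<open>x\<close>, the commutator of \<open>t\<close> and \<open>w\<close> would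
  be \<open>t\<^sup>2\<close>, and since squaring is at most two-to-one there, the lower central series would never become
  finite. So \<open>D\<close> lies in the centraliser of \<open>x\<close>. A Cartan subgroup is therefore such a centraliser;
  the unipotent ones have infinite index in their normaliser, whereas for semisimple \<open>x\<close> the
  index is at most \<open>2\<close>. The remaining ones are sorted by the square class of \<open>- det z\<close>.
\<close>

section \<open>Commuting two-by-two matrices\<close>

lemma mat2_nth [simp]:
  "mat2 a b c d $ 1 $ 1 = a" "mat2 a b c d $ 1 $ 2 = b"
  "mat2 a b c d $ 2 $ 1 = c" "mat2 a b c d $ 2 $ 2 = d"
  by (simp_all add: mat2_def)

lemma mat2_eq_iff: "A = B \<longleftrightarrow> A$1$1 = B$1$1 \<and> A$1$2 = B$1$2 \<and> A$2$1 = B$2$1 \<and> A$2$2 = B$2$2"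
  for A B :: "'a^2^2"
  by (auto simp: vec_eq_iff forall_2)

lemma mat2_exhaust:
  obtains a b c d where "A = mat2 a b c d"
  using mat2_eq_iff[of A] that by (metis mat2_nth)

lemma mat2_inject [simp]:
  "mat2 a b c d = mat2 a' b' c' d' \<longleftrightarrow> a = a' \<and> b = b' \<and> c = c' \<and> d = d'"
  by (simp add: mat2_eq_iff)

lemma mat2_mult [simp]:
  "mat2 a b c d ** mat2 a' b' c' d' =
    mat2 (a * a' + b * c') (a * b' + b * d') (c * a' + d * c') (c * b' + d * d')"
  by (simp add: mat2_eq_iff matrix_matrix_mult_def sum_2)

lemma mat2_uminus [simp]: "- mat2 a b c d = mat2 (- a) (- b) (- c) (- d)"
  by (simp add: mat2_eq_iff)

lemma mat_eq_mat2: "mat c = mat2 c 0 0 c"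
  by (simp add: mat2_eq_iff mat_def)

lemma det_mat2 [simp]: "det (mat2 a b c d) = a * d - b * c"
  by (simp add: det_2)

lemma trace_mat2 [simp]: "trace (mat2 a b c d) = a + d"
  by (simp add: trace_def sum_2)

text \<open>The elements \<open>A\<close> have determinant 1, but \<open>z\<close> is an arbitrary
  matrix, so that a torus can be described by a traceless \<open>z\<close>, which may be rescaled or
  conjugated in \<open>GL2\<close>.\<close>

definition mat_centralizer :: "'k::field^2^2 \<Rightarrow> ('k^2^2) set" where
  "mat_centralizer z = {A. det A = 1 \<and> A ** z = z ** A}"

text \<open>Two matrices commute exactly when their vectors (upper right entry, lower left entry,
  difference of the diagonal entries) are proportional. A non-scalar \<open>y\<close> has a nonzero
  vector, and two vectors proportional to a common nonzero vector are proportional to each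
  other.\<close>

lemma commute_trans:
  fixes x y z :: "'k::field^2^2"
  assumes "x ** y = y ** x" "y ** z = z ** y" "y \<notin> range mat"
  shows "x ** z = z ** x"
proof -
  obtain a b c d where x: "x = mat2 a b c d" by (rule mat2_exhaust)
  obtain e f g h where y: "y = mat2 e f g h" by (rule mat2_exhaust)
  obtain p q r s where z: "z = mat2 p q r s" by (rule mat2_exhaust)
  have "f \<noteq> 0 \<or> g \<noteq> 0 \<or> e - h \<noteq> 0"
    using assms(3) by (auto simp: y mat_eq_mat2 image_iff)
  \<comment> \<open>Vanishing of the minors of the pairs \<open>x\<close>, \<open>y\<close> and
    \<open>y\<close>, \<open>z\<close>.\<close>
  moreover have 1: "b * g = f * c" "(a - d) * f = (e - h) * b" "(a - d) * g = (e - h) * c"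
    "f * r = q * g" "(e - h) * q = (p - s) * f" "(e - h) * r = (p - s) * g"
    using assms(1,2) by (auto simp: x y z) algebra+
  \<comment> \<open>Each minor of the pair \<open>x\<close>, \<open>z\<close> is killed by all three
    coordinates of the vector of \<open>y\<close>, one of which is nonzero.\<close>
  have "f * (b * r - q * c) = 0" "f * ((a - d) * q - (p - s) * b) = 0" "f * ((a - d) * r - (p - s) * c) = 0"
    "g * (b * r - q * c) = 0" "g * ((a - d) * q - (p - s) * b) = 0" "g * ((a - d) * r - (p - s) * c) = 0"
    "(e - h) * (b * r - q * c) = 0" "(e - h) * ((a - d) * q - (p - s) * b) = 0"
    "(e - h) * ((a - d) * r - (p - s) * c) = 0"
    using 1 by algebra+
  ultimately have "b * r = q * c" "(a - d) * q = (p - s) * b" "(a - d) * r = (p - s) * c"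
    by auto
  then show ?thesis by (simp add: x z) algebra
qed


text \<open>A traceless \<open>z\<close> satisfies \<open>z ** z = mat \<delta>\<close> with
  \<delta> = - det z. For \<delta> \<noteq> 0 its centraliser in the matrix algebra is K[z], and the
  matrix obtained here is a + b z.\<close>

lemma commute_form:
  fixes t :: "'k::field^2^2"
  assumes "t ** mat2 p q r (- p) = mat2 p q r (- p) ** t" "p * p + q * r \<noteq> 0" "(2::'k) \<noteq> 0"
  obtains a b where "t = mat2 (a + b * p) (b * q) (b * r) (a - b * p)"
proof -
  obtain e f g h where t: "t = mat2 e f g h" by (rule mat2_exhaust)
  define a where "a = (e + h) / 2"
  have a: "2 * a = e + h" using assms(3) by (simp add: a_def)
  have c: "f * r = q * g" "2 * p * f = (e - h) * q" "2 * p * g = (e - h) * r"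
    using assms(1) by (auto simp: t) algebra+
  define \<delta> where "\<delta> = p * p + q * r"
  \<comment> \<open>If t = a + b z, then t has trace 2 a and t z has trace 2 \<delta> b; the
    numerator is the trace of t z.\<close>
  define b where "b = ((e - h) * p + f * r + q * g) / (2 * \<delta>)"
  have b: "2 * \<delta> * b = (e - h) * p + f * r + q * g"
    using assms(2,3) by (simp add: b_def flip: \<delta>_def)
  have "2 * \<delta> * (b * q - f) = 0" "2 * \<delta> * (b * r - g) = 0" "2 * \<delta> * (2 * b * p - (e - h)) = 0"
    using b c unfolding \<delta>_def by algebra+
  then have bq: "b * q = f" "b * r = g" "2 * b * p = e - h"
    using assms(2,3) by (auto simp flip: \<delta>_def)
  have "2 * (a + b * p) = 2 * e" "2 * (a - b * p) = 2 * h" using a bq by algebra+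
  then have "a + b * p = e" "a - b * p = h" using assms(3) by (simp_all only: mult_cancel_left) auto
  then have "t = mat2 (a + b * p) (b * q) (b * r) (a - b * p)"
    using bq by (simp add: t)
  then show thesis by (rule that)
qed

lemma traceless_form:
  assumes "trace z = 0"
  obtains p q r where "z = mat2 p q r (- p)" "det z = - (p * p + q * r)"
proof -
  obtain p q r s where z: "z = mat2 p q r s" by (rule mat2_exhaust)
  have "s = - p" using assms by (simp add: z eq_neg_iff_add_eq_0 add.commute)
  then show thesis using that by (simp add: z)
qed

lemma nonscalar_traceless:
  fixes z :: "'k::field^2^2"
  assumes "trace z = 0" "det z \<noteq> 0" "(2::'k) \<noteq> 0"
  shows "z \<notin> range mat"
proof -
  from assms(1) obtain p q r where z: "z = mat2 p q r (- p)" "det z = - (p * p + q * r)"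
    by (rule traceless_form)
  have "p = - p \<Longrightarrow> 2 * p = 0" by algebra
  then show ?thesis using assms z by (auto simp: mat_eq_mat2)
qed

text \<open>Write t = a + b z. Moving \<open>w\<close> across \<open>z\<close> changes the sign of
  \<open>z\<close>, so w t = (a - b z) w, and a - b z is the inverse of \<open>t\<close> because det
  t = 1. Thus \<open>w\<close> inverts the torus of \<open>z\<close> by conjugation.\<close>

lemma anticommute_conj_inverse:
  fixes t w z :: "'k::field^2^2"
  assumes "w ** z = - (z ** w)" "t \<in> mat_centralizer z"
    "trace z = 0" "det z \<noteq> 0" "(2::'k) \<noteq> 0"
  shows "t ** w ** t = w"
proof -
  from assms(3) obtain p q r where z: "z = mat2 p q r (- p)" "det z = - (p * p + q * r)"
    by (rule traceless_form)
  obtain a b where t: "t = mat2 (a + b * p) (b * q) (b * r) (a - b * p)"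
    using commute_form[of t p q r] assms(2,4,5) z by (auto simp: mat_centralizer_def add_eq_0_iff)
  obtain e f g h where w: "w = mat2 e f g h" by (rule mat2_exhaust)
  have d: "(a + b * p) * (a - b * p) - (b * q) * (b * r) = 1"
    using assms(2) by (simp add: mat_centralizer_def t)
  have "2 * p * e = - (f * r + q * g)" "q * (e + h) = 0" "r * (e + h) = 0" "2 * p * h = f * r + q * g"
    using assms(1) by (auto simp: z w) algebra+
  \<comment> \<open>Up to a factor 2, the trace \<open>e + h\<close> of \<open>w\<close> is killed
    by every entry of \<open>z\<close>. Since \<open>z\<close> is nonzero, \<open>w\<close> is
    traceless.\<close>
  then have e: "q * (e + h) = 0" "r * (e + h) = 0" "2 * p * (e + h) = 0"
    "2 * p * e + f * r + q * g = 0"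
    by algebra+
  then have "p * (e + h) = 0" using assms(5) by auto
  with e have "e + h = 0" using z assms(4) by auto
  then have "h = - e" by algebra
  show ?thesis unfolding t w mat2_mult mat2_inject \<open>h = - e\<close>
    using d e(4) by (intro conjI) algebra+
qed

lemma centralizer_traceless:
  fixes z y :: "'k::field^2^2"
  assumes "y ** z = z ** y" "trace z = 0" "trace y = 0" "det y = det z" "det z \<noteq> 0" "(2::'k) \<noteq> 0"
  shows "y = z \<or> y = - z"
proof -
  from assms(2) obtain p q r where z: "z = mat2 p q r (- p)" "det z = - (p * p + q * r)"
    by (rule traceless_form)
  obtain a b where y: "y = mat2 (a + b * p) (b * q) (b * r) (a - b * p)"
    using commute_form[of y p q r] assms z by (auto simp: add_eq_0_iff)
  have "2 * a = 0" using assms(3) by (simp add: y) 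
  then have "a = 0" using assms(6) by simp
  then have "(b - 1) * (b + 1) * (p * p + q * r) = 0"
    using assms(4) z(2) by (simp add: y) algebra
  moreover have "p * p + q * r \<noteq> 0" using assms(5) z(2) by (metis neg_equal_0_iff_equal)
  ultimately have "b = 1 \<or> b = -1" by (simp add: eq_neg_iff_add_eq_0 del: add_eq_0_iff)
  then show ?thesis using \<open>a = 0\<close> by (auto simp: y z)
qed

text \<open>By Cayley-Hamilton a matrix of determinant 1 satisfies s s = (tr s) s - 1, so equal
  squares give (tr s) s = (tr t) t and traces equal up to sign. If the traces are nonzero, divide by
  them; if they vanish, the commuting traceless matrices \<open>s\<close> and \<open>t\<close> of
  equal determinant agree up to sign.\<close>

lemma commute_square_eq:
  fixes s t :: "'k::field^2^2"
  assumes "s ** t = t ** s" "s ** s = t ** t" "det s = 1" "det t = 1" "(2::'k) \<noteq> 0"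
  shows "s = t \<or> s = - t"
proof -
  obtain a b c d where s: "s = mat2 a b c d" by (rule mat2_exhaust)
  obtain e f g h where t: "t = mat2 e f g h" by (rule mat2_exhaust)
  have sq: "a * a + b * c = e * e + f * g" "b * (a + d) = f * (e + h)" "c * (a + d) = g * (e + h)"
    "b * c + d * d = f * g + h * h"
    using assms(2) by (auto simp: s t) algebra+
  have det: "a * d - b * c = 1" "e * h - f * g = 1"
    using assms(3,4) by (auto simp: s t)
  have tr: "a * (a + d) = e * (e + h)" "d * (a + d) = h * (e + h)" "((a + d) - (e + h)) * ((a + d) + (e + h)) = 0"
    using sq det by algebra+
  show ?thesis
  proof (cases "a + d = 0")
    case True
    moreover have "e + h = 0" using tr(3) unfolding True by auto
    ultimately have "trace s = 0" "trace t = 0" by (simp_all add: s t)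
    then show ?thesis using centralizer_traceless[of s t] assms by simp
  next
    case False
    from tr(3) consider "e + h = a + d" | "e + h = - (a + d)"
      by (metis add_eq_0_iff eq_iff_diff_eq_0 mult_eq_0_iff)
    then show ?thesis
    proof cases
      case 1
      then show ?thesis using False sq tr by (simp add: s t)
    next
      case 2
      have "(a + e) * (a + d) = 0" "(b + f) * (a + d) = 0" "(c + g) * (a + d) = 0" "(d + h) * (a + d) = 0"
        using sq tr 2 by algebra+
      then show ?thesis using False by (simp add: s t eq_neg_iff_add_eq_0)
    qed
  qed
qed

text \<open>The matrices a + b z of determinant 1 are the points of the conic a a - \<delta> b b = 1
  with \<delta> = - det z. The conic has the rational point (-1, 0), hence a rational
  parametrisation and infinitely many points.\<close>

lemma infinite_mat_centralizer:
  fixes z :: "'k::field^2^2"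
  assumes "infinite (UNIV :: 'k set)" "(2::'k) \<noteq> 0" "trace z = 0" "det z \<noteq> 0"
  shows "infinite (mat_centralizer z)"
proof -
  from assms(3) obtain p q r where z: "z = mat2 p q r (- p)" "det z = - (p * p + q * r)"
    by (rule traceless_form)
  define \<delta> where "\<delta> = p * p + q * r"
  define S where "S = {u. 1 - \<delta> * u\<^sup>2 \<noteq> 0}"
  \<comment> \<open>Second intersection of the conic with the line of slope \<open>u\<close> through
    (-1, 0).\<close>
  define f where "f u = (let a = (1 + \<delta> * u\<^sup>2) / (1 - \<delta> * u\<^sup>2); b = 2 * u / (1 - \<delta> * u\<^sup>2) in
    mat2 (a + b * p) (b * q) (b * r) (a - b * p))" for u
  have "finite {u. 1 - \<delta> * u\<^sup>2 = 0}"
  proof -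
    have "{u. 1 - \<delta> * u\<^sup>2 = 0} \<subseteq> {v, - v}" if "1 - \<delta> * v\<^sup>2 = 0" for v
    proof
      fix u assume "u \<in> {u. 1 - \<delta> * u\<^sup>2 = 0}"
      with that have "\<delta> * ((u - v) * (u + v)) = 0" by simp algebra
      moreover have "\<delta> \<noteq> 0" using assms(4) z(2) by (metis \<delta>_def neg_equal_0_iff_equal)
      ultimately show "u \<in> {v, - v}" by (auto simp: eq_neg_iff_add_eq_0)
    qed
    then show ?thesis by (cases "{u. 1 - \<delta> * u\<^sup>2 = 0} = {}") (auto intro: finite_subset)
  qed
  then have "infinite (UNIV - {u. 1 - \<delta> * u\<^sup>2 = 0})" using assms(1) by (simp add: Diff_infinite_finite)
  then have "infinite S" by (simp add: S_def Compl_eq_Diff_UNIV[symmetric] Collect_neg_eq[symmetric])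
  moreover have "inj_on f S"
  proof (rule inj_onI)
    fix u v assume uv: "u \<in> S" "v \<in> S" "f u = f v"
    define a where "a u = (1 + \<delta> * u\<^sup>2) / (1 - \<delta> * u\<^sup>2)" for u
    define b where "b u = 2 * u / (1 - \<delta> * u\<^sup>2)" for u
    have ab: "a u + b u * p = a v + b v * p" "b u * q = b v * q" "b u * r = b v * r" "a u - b u * p = a v - b v * p"
      using uv(3) by (auto simp: f_def a_def b_def Let_def)
    have "2 * (a u - a v) = 0" "2 * ((b u - b v) * p) = 0" using ab by algebra+
    then have "a u = a v" "(b u - b v) * p = 0" using assms(2) by auto
    then have "b u = b v" using ab(2,3) z(2) assms(4) by auto
    \<comment> \<open>The parameter is recovered as the slope, which gives injectivity.\<close>
    have *: "u = b u / (a u + 1)" if "u \<in> S" for u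
    proof -
      have "a u + 1 = 2 / (1 - \<delta> * u\<^sup>2)" using that by (simp add: a_def S_def field_simps)
      then show ?thesis using that assms(2) by (simp add: b_def S_def)
    qed
    show "u = v" using *[OF uv(1)] *[OF uv(2)] \<open>a u = a v\<close> \<open>b u = b v\<close> by simp
  qed
  moreover have "f ` S \<subseteq> mat_centralizer z"
  proof clarify
    fix u assume "u \<in> S"
    define a where "a = (1 + \<delta> * u\<^sup>2) / (1 - \<delta> * u\<^sup>2)"
    define b where "b = 2 * u / (1 - \<delta> * u\<^sup>2)"
    have "a * (1 - \<delta> * u\<^sup>2) = 1 + \<delta> * u\<^sup>2" "b * (1 - \<delta> * u\<^sup>2) = 2 * u"
      using \<open>u \<in> S\<close> by (simp_all add: a_def b_def S_def)
    then have "(1 - \<delta> * u\<^sup>2)\<^sup>2 * (a * a - b * b * \<delta> - 1) = 0" by algebra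
    then have "a * a - b * b * \<delta> = 1" using \<open>u \<in> S\<close> by (simp add: S_def)
    then show "f u \<in> mat_centralizer z"
      by (simp add: mat_centralizer_def f_def flip: a_def b_def)
        (simp add: z \<delta>_def algebra_simps)
  qed
  ultimately show ?thesis using finite_imageD finite_subset by blast
qed

section \<open>Nilpotent subgroups\<close>

lemma SL2_simps [simp]:
  "x \<otimes>\<^bsub>SL2\<^esub> y = x ** y" "\<one>\<^bsub>SL2\<^esub> = mat 1" "x \<in> carrier SL2 \<longleftrightarrow> det x = 1"
  by (simp_all add: SL2_def)

lemma mat2_minus_mult [simp]:
  fixes A B :: "'k::field^2^2"
  shows "(- A) ** B = - (A ** B)" "A ** (- B) = - (A ** B)"
  by (simp_all add: mat2_eq_iff matrix_matrix_mult_def sum_2)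

section \<open>Commutators and the lower central series in general groups\<close>

lemma lower_central_subset:
  assumes "group G"
  shows "lower_central G n \<subseteq> carrier G"
proof (induction n)
  case (Suc n)
  interpret group G by fact
  show ?case using Suc by (auto intro!: generate_incl)
qed simp

lemma commutator_in_lower_central:
  "x \<in> lower_central G n \<Longrightarrow> y \<in> carrier G \<Longrightarrow>
    x \<otimes>\<^bsub>G\<^esub> y \<otimes>\<^bsub>G\<^esub> inv\<^bsub>G\<^esub> x \<otimes>\<^bsub>G\<^esub> inv\<^bsub>G\<^esub> y \<in> lower_central G (Suc n)"
  by (auto intro!: generate.incl)

text \<open>The hypothesis says that \<open>w\<close> conjugates \<open>inv t\<close> to
  \<open>t\<close>; the commutator is \<open>t\<close> times this conjugate.\<close>

lemma (in group) commutator_eq_square: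
  assumes "t \<in> carrier G" "w \<in> carrier G" "t \<otimes> w \<otimes> t = w"
  shows "t \<otimes> w \<otimes> inv t \<otimes> inv w = t \<otimes> t"
proof -
  have "w \<otimes> inv t = t \<otimes> w" using assms by (metis inv_solve_right m_closed)
  then have "t \<otimes> w \<otimes> inv t \<otimes> inv w = t \<otimes> (t \<otimes> w) \<otimes> inv w"
    using assms(1,2) by (simp add: m_assoc)
  then show ?thesis using assms(1,2) by (simp add: m_assoc)
qed

text \<open>Take the term just before the first term of the lower central series contained in
  \<open>Z\<close>, and in it an element outside \<open>Z\<close>. Its commutators lie in the next
  term, hence in \<open>Z\<close>.\<close>

lemma nilpotent_group_central_mod:
  assumes "nilpotent_group G" "\<one>\<^bsub>G\<^esub> \<in> Z" "\<not> carrier G \<subseteq> Z"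
  obtains x where "x \<in> carrier G - Z"
    "\<And>y. y \<in> carrier G \<Longrightarrow> x \<otimes>\<^bsub>G\<^esub> y \<otimes>\<^bsub>G\<^esub> inv\<^bsub>G\<^esub> x \<otimes>\<^bsub>G\<^esub> inv\<^bsub>G\<^esub> y \<in> Z"
proof -
  obtain N where "lower_central G N = {\<one>\<^bsub>G\<^esub>}"
    using assms(1) by (auto simp: nilpotent_group_def)
  then have N: "lower_central G N \<subseteq> Z" using assms(2) by simp
  define n where "n = (LEAST n. lower_central G n \<subseteq> Z)"
  have n: "lower_central G n \<subseteq> Z" unfolding n_def using N by (rule LeastI)
  have "n \<noteq> 0" using n assms(3) by (metis lower_central.simps(1))
  then obtain m where m: "n = Suc m" using not0_implies_Suc by blast
  then have "\<not> lower_central G m \<subseteq> Z" using not_less_Least[of m "\<lambda>n. lower_central G n \<subseteq> Z"] by (simp add: n_def)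
  then obtain x where x: "x \<in> lower_central G m" "x \<notin> Z" by blast
  then have "x \<in> carrier G"
    using lower_central_subset assms(1) by (auto simp: nilpotent_group_def)
  show thesis
  proof (rule that)
    show "x \<in> carrier G - Z" using \<open>x \<in> carrier G\<close> x(2) by simp
    show "x \<otimes>\<^bsub>G\<^esub> y \<otimes>\<^bsub>G\<^esub> inv\<^bsub>G\<^esub> x \<otimes>\<^bsub>G\<^esub> inv\<^bsub>G\<^esub> y \<in> Z" if "y \<in> carrier G" for y
      using commutator_in_lower_central[OF x(1) that] n m by (metis subsetD)
  qed
qed

lemma commutative_imp_nilpotent_subgroup:
  assumes "group G" "subgroup H G" "\<And>x y. x \<in> H \<Longrightarrow> y \<in> H \<Longrightarrow> x \<otimes>\<^bsub>G\<^esub> y = y \<otimes>\<^bsub>G\<^esub> x"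
  shows "nilpotent_subgroup G H"
proof -
  interpret H: group "G\<lparr>carrier := H\<rparr>"
    by (rule group.subgroup_imp_group[OF assms(1,2)])
  let ?H = "G\<lparr>carrier := H\<rparr>"
  have "x \<otimes>\<^bsub>?H\<^esub> y \<otimes>\<^bsub>?H\<^esub> inv\<^bsub>?H\<^esub> x \<otimes>\<^bsub>?H\<^esub> inv\<^bsub>?H\<^esub> y = \<one>\<^bsub>?H\<^esub>" if "x \<in> H" "y \<in> H" for x y
  proof -
    have "x \<otimes>\<^bsub>?H\<^esub> y = y \<otimes>\<^bsub>?H\<^esub> x" using that assms(3) by simp
    moreover have "x \<in> carrier ?H" "y \<in> carrier ?H" using that by simp_all
    ultimately show ?thesis
      by (metis H.inv_closed H.inv_mult_group H.m_assoc H.m_closed H.r_inv)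
  qed
  then have "(\<Union>x\<in>H. \<Union>y\<in>H. {x \<otimes>\<^bsub>?H\<^esub> y \<otimes>\<^bsub>?H\<^esub> inv\<^bsub>?H\<^esub> x \<otimes>\<^bsub>?H\<^esub> inv\<^bsub>?H\<^esub> y}) = {\<one>\<^bsub>?H\<^esub>}"
    using H.one_closed by auto
  then have "lower_central ?H 1 = {\<one>\<^bsub>?H\<^esub>}"
    using H.generate_one by simp
  then show ?thesis
    using assms(2) H.is_group unfolding nilpotent_subgroup_def nilpotent_group_def by blast
qed

section \<open>Nilpotent subgroups of \<open>SL2\<close> and centralisers of matrices\<close>

lemma subgroup_mat_centralizer: "subgroup (mat_centralizer z) SL2"
proof -
  interpret group "SL2 :: ('a^2^2) monoid" by (rule group_SL2)
  show ?thesis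
  proof (rule subgroupI)
    show "mat_centralizer z \<subseteq> carrier SL2" by (auto simp: mat_centralizer_def)
    show "mat_centralizer z \<noteq> {}" by (auto simp: mat_centralizer_def intro: exI[of _ "mat 1"])
  next
    fix a assume a: "a \<in> mat_centralizer z"
    then have c: "a \<in> carrier SL2" by (simp add: mat_centralizer_def)
    have i: "inv\<^bsub>SL2\<^esub> a ** a = mat 1" "a ** inv\<^bsub>SL2\<^esub> a = mat 1" "det (inv\<^bsub>SL2\<^esub> a) = 1"
      using l_inv[OF c] r_inv[OF c] inv_closed[OF c] by simp_all
    have "inv\<^bsub>SL2\<^esub> a ** z = inv\<^bsub>SL2\<^esub> a ** (z ** a) ** inv\<^bsub>SL2\<^esub> a"
      using i by (simp add: matrix_mul_assoc[symmetric])
    also have "\<dots> = inv\<^bsub>SL2\<^esub> a ** (a ** z) ** inv\<^bsub>SL2\<^esub> a" using a by (simp add: mat_centralizer_def)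
    also have "\<dots> = z ** inv\<^bsub>SL2\<^esub> a" using i by (simp add: matrix_mul_assoc)
    finally show "inv\<^bsub>SL2\<^esub> a \<in> mat_centralizer z" using i by (simp add: mat_centralizer_def)
  next
    fix a b assume ab: "a \<in> mat_centralizer z" "b \<in> mat_centralizer z"
    have "a ** b ** z = a ** (b ** z)" by (simp add: matrix_mul_assoc)
    also have "\<dots> = a ** z ** b" using ab(2) by (simp add: mat_centralizer_def matrix_mul_assoc)
    also have "\<dots> = z ** (a ** b)" using ab(1) by (simp add: mat_centralizer_def matrix_mul_assoc)
    finally show "a \<otimes>\<^bsub>SL2\<^esub> b \<in> mat_centralizer z"
      using ab by (simp add: mat_centralizer_def det_mul)
  qed
qed

lemma mat_centralizer_commute:
  assumes "z \<notin> range mat" "s \<in> mat_centralizer z" "t \<in> mat_centralizer z"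
  shows "s ** t = t ** s"
  using commute_trans[of s z t] assms by (simp add: mat_centralizer_def)

lemma nilpotent_subgroup_mat_centralizer:
  assumes "z \<notin> range mat"
  shows "nilpotent_subgroup SL2 (mat_centralizer z)"
  using mat_centralizer_commute[OF assms]
  by (intro commutative_imp_nilpotent_subgroup group_SL2 subgroup_mat_centralizer) simp

lemma scalar_det_1:
  fixes A :: "'k::field^2^2"
  assumes "det A = 1" "A \<in> range mat"
  shows "A = mat 1 \<or> A = - mat 1"
proof -
  obtain c where "A = mat2 c 0 0 c" using assms(2) by (auto simp: mat_eq_mat2)
  moreover from this have "c = 1 \<or> c = - 1" using assms(1) by (simp flip: square_eq_1_iff)
  ultimately show ?thesis by (auto simp: mat_eq_mat2)
qed

text \<open>Elements of \<open>T\<close> commute with each other, so by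
  \<open>commute_square_eq\<close> the fibres of squaring have at most two elements, and the image
  of an infinite set is infinite.\<close>

lemma infinite_squares:
  fixes z :: "'k::field^2^2"
  assumes "z \<notin> range mat" "(2::'k) \<noteq> 0" "T \<subseteq> mat_centralizer z" "infinite T"
  shows "infinite ((\<lambda>t. t ** t) ` T)"
proof
  assume "finite ((\<lambda>t. t ** t) ` T)"
  from pigeonhole_infinite[OF assms(4) this]
  obtain t0 where t0: "t0 \<in> T" "infinite {t \<in> T. t ** t = t0 ** t0}" by blast
  have "{t \<in> T. t ** t = t0 ** t0} \<subseteq> {t0, - t0}"
  proof
    fix t assume "t \<in> {t \<in> T. t ** t = t0 ** t0}"
    moreover from this have "t ** t0 = t0 ** t"
      using mat_centralizer_commute[OF assms(1)] assms(3) t0(1) by blast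
    moreover have "det s = 1" if "s \<in> T" for s
      using that assms(3) by (auto simp: mat_centralizer_def)
    ultimately show "t \<in> {t0, - t0}"
      using commute_square_eq[of t t0] assms(2) t0(1) by simp
  qed
  then show False using t0(2) finite_subset by blast
qed

text \<open>This excludes the minus sign. Since \<open>w\<close> inverts the torus, the commutator
  of \<open>t\<close> and \<open>w\<close> is the square of \<open>t\<close>; were the intersection
  infinite, repeated squaring would keep every term of the lower central series infinite.\<close>

lemma nilpotent_anticommute_finite:
  fixes z :: "'k::field^2^2"
  assumes D: "nilpotent_subgroup SL2 D" and w: "w \<in> D" "w ** z = - (z ** w)"
    and z: "trace z = 0" "det z \<noteq> 0" and two: "(2::'k) \<noteq> 0"
  shows "finite (D \<inter> mat_centralizer z)"
proof (rule ccontr)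
  assume inf: "infinite (D \<inter> mat_centralizer z)"
  interpret group "SL2 :: ('k^2^2) monoid" by (rule group_SL2)
  interpret C: subgroup "mat_centralizer z" SL2 by (rule subgroup_mat_centralizer)
  have sub: "subgroup D SL2" using D by (simp add: nilpotent_subgroup_def)
  let ?D = "SL2\<lparr>carrier := D\<rparr>"
  have grp: "group ?D" using sub by (rule subgroup_imp_group)
  have "infinite (lower_central ?D n \<inter> mat_centralizer z)" for n
  proof (induction n)
    case 0
    then show ?case using inf by simp
  next
    case (Suc n)
    have "t ** t \<in> lower_central ?D (Suc n)" if t: "t \<in> lower_central ?D n \<inter> mat_centralizer z" for t
    proof -
      have tD: "t \<in> D" using lower_central_subset[OF grp] t by auto
      then have c: "t \<in> carrier SL2" "w \<in> carrier SL2" using sub w(1) by (auto dest: subgroup.mem_carrier)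
      have "t \<otimes>\<^bsub>SL2\<^esub> w \<otimes>\<^bsub>SL2\<^esub> t = w"
        using anticommute_conj_inverse[OF w(2) _ z two] t by simp
      then have "t \<otimes>\<^bsub>SL2\<^esub> w \<otimes>\<^bsub>SL2\<^esub> inv\<^bsub>SL2\<^esub> t \<otimes>\<^bsub>SL2\<^esub> inv\<^bsub>SL2\<^esub> w = t \<otimes>\<^bsub>SL2\<^esub> t"
        using c by (intro commutator_eq_square)
      then show ?thesis
        using commutator_in_lower_central[of t ?D n w] t w(1) tD
        by (simp add: m_inv_consistent[OF sub])
    qed
    then have "(\<lambda>t. t ** t) ` (lower_central ?D n \<inter> mat_centralizer z)
        \<subseteq> lower_central ?D (Suc n) \<inter> mat_centralizer z"
      using C.m_closed by auto
    moreover have "infinite ((\<lambda>t. t ** t) ` (lower_central ?D n \<inter> mat_centralizer z))"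
      using infinite_squares[OF nonscalar_traceless[OF z two] two _ Suc] by blast
    ultimately show ?case using finite_subset by blast
  qed
  moreover obtain n where "lower_central ?D n = {\<one>\<^bsub>?D\<^esub>}"
    using D unfolding nilpotent_subgroup_def nilpotent_group_def by blast
  ultimately show False by (metis finite.emptyI finite_Int finite_insert)
qed

text \<open>Here \<open>x\<close> is conjugate to its negative, so its trace equals minus
  itself.\<close>

lemma anticommute_traceless:
  fixes x d :: "'k::field^2^2"
  assumes "x ** d = - (d ** x)" "det d = 1" "(2::'k) \<noteq> 0"
  shows "trace x = 0"
proof -
  obtain a b c e where x: "x = mat2 a b c e" by (rule mat2_exhaust)
  obtain p q r s where d: "d = mat2 p q r s" by (rule mat2_exhaust)
  have "2 * (a + e) = 0"
    using assms(1,2) unfolding x d mat2_mult mat2_uminus mat2_inject det_mat2 by algebra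
  then have "a + e = 0" using assms(3) by (metis mult_eq_0_iff)
  then show ?thesis by (simp add: x)
qed

text \<open>An element central modulo \<open>{mat 1, - mat 1}\<close> commutes with all of
  \<open>D\<close> up to sign. The infinite \<open>D\<close> is not contained in this set, and in
  \<open>SL2\<close> the elements outside it are non-scalar.\<close>

lemma nilpotent_subgroup_SL2_obtain:
  fixes D :: "('k::field^2^2) set"
  assumes "nilpotent_subgroup SL2 D" "infinite D"
  obtains x where "x \<in> D" "x \<notin> range mat" "\<And>d. d \<in> D \<Longrightarrow> x ** d = d ** x \<or> x ** d = - (d ** x)"
proof -
  interpret group "SL2 :: ('k^2^2) monoid" by (rule group_SL2)
  let ?D = "SL2\<lparr>carrier := D\<rparr>"
  have sub: "subgroup D SL2" using assms(1) by (simp add: nilpotent_subgroup_def)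
  have "\<not> D \<subseteq> {mat 1, - mat 1}" using assms(2) finite_subset by auto
  with assms(1) obtain x where x: "x \<in> D - {mat 1, - mat 1}"
    "\<And>y. y \<in> D \<Longrightarrow> x ** y ** inv\<^bsub>?D\<^esub> x ** inv\<^bsub>?D\<^esub> y \<in> {mat 1, - mat 1}"
    using nilpotent_group_central_mod[of ?D "{mat 1, - mat 1}"] by (auto simp: nilpotent_subgroup_def)
  have "x \<notin> range mat" using x(1) scalar_det_1[of x] subgroup.mem_carrier[OF sub] by auto
  moreover have "x ** d = d ** x \<or> x ** d = - (d ** x)" if d: "d \<in> D" for d
  proof -
    define e where "e = x ** d ** inv\<^bsub>SL2\<^esub> x ** inv\<^bsub>SL2\<^esub> d"
    have e: "e \<in> {mat 1, - mat 1}" using x d by (simp add: m_inv_consistent[OF sub] e_def)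
    have c: "x \<in> carrier SL2" "d \<in> carrier SL2" using x(1) d sub by (auto dest: subgroup.mem_carrier)
    have "inv\<^bsub>SL2\<^esub> x ** x = mat 1" "inv\<^bsub>SL2\<^esub> d ** d = mat 1"
      using l_inv[OF c(1)] l_inv[OF c(2)] by simp_all
    \<comment> \<open>The commutator \<open>e\<close> is the sign in the relation between the two
      products.\<close>
    moreover have "e ** (d ** x) = x ** d ** (inv\<^bsub>SL2\<^esub> x ** (inv\<^bsub>SL2\<^esub> d ** d) ** x)"
      by (simp add: e_def matrix_mul_assoc)
    ultimately have "e ** (d ** x) = x ** d" by simp
    then show ?thesis using e by auto
  qed
  ultimately show thesis using that[of x] x(1) by simp
qed

lemma mat_centralizer_eq:
  fixes x z :: "'k::field^2^2"
  assumes "x ** z = z ** x" "x \<notin> range mat" "z \<notin> range mat"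
  shows "mat_centralizer x = mat_centralizer z"
proof -
  have "A ** x = x ** A \<longleftrightarrow> A ** z = z ** A" for A :: "'k^2^2"
  proof
    assume "A ** x = x ** A"
    from commute_trans[OF this assms(1,2)] show "A ** z = z ** A" .
  next
    assume "A ** z = z ** A"
    from commute_trans[OF this assms(1)[symmetric] assms(3)] show "A ** x = x ** A" .
  qed
  then show ?thesis unfolding mat_centralizer_def by blast
qed

text \<open>A nilpotent \<open>D\<close> above the torus has an element \<open>x\<close> as in
  \<open>nilpotent_subgroup_SL2_obtain\<close>. First \<open>x\<close> is shown to have the same
  centraliser as \<open>z\<close>, then every \<open>d\<close> in \<open>D\<close> to commute with
  \<open>x\<close>.\<close>

lemma maximal_nilpotent_mat_centralizer:
  fixes z :: "'k::field^2^2"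
  assumes "infinite (UNIV :: 'k set)" "(2::'k) \<noteq> 0" "trace z = 0" "det z \<noteq> 0"
  shows "maximal_nilpotent_subgroup SL2 (mat_centralizer z)"
  unfolding maximal_nilpotent_subgroup_def
proof (intro conjI allI impI)
  have nz: "z \<notin> range mat" using assms by (intro nonscalar_traceless)
  then show "nilpotent_subgroup SL2 (mat_centralizer z)" by (rule nilpotent_subgroup_mat_centralizer)
  have inf: "infinite (mat_centralizer z)" using assms by (rule infinite_mat_centralizer)
  fix D assume D: "nilpotent_subgroup SL2 D \<and> mat_centralizer z \<subseteq> D"
  then have "infinite D" using inf finite_subset by blast
  with D obtain x where x: "x \<in> D" "x \<notin> range mat"
    "\<And>d. d \<in> D \<Longrightarrow> x ** d = d ** x \<or> x ** d = - (d ** x)"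
    using nilpotent_subgroup_SL2_obtain by blast
  have D1: "det d = 1" if "d \<in> D" for d
    using D that by (auto simp: nilpotent_subgroup_def dest: subgroup.mem_carrier)
  \<comment> \<open>The aim is a \<open>t\<close> in the torus with non-scalar square:
    \<open>x\<close> commutes with \<open>t\<close> only up to sign, but with its square exactly,
    and this square links \<open>x\<close> to \<open>z\<close>.\<close>
  have "infinite ((\<lambda>t. t ** t) ` mat_centralizer z)"
    using infinite_squares[OF nz assms(2) subset_refl inf] .
  then have "\<not> (\<lambda>t. t ** t) ` mat_centralizer z \<subseteq> {mat 1, - mat 1}" using finite_subset by auto
  then obtain t where t: "t \<in> mat_centralizer z" "t ** t \<notin> {mat 1, - mat 1}" by blast
  have tt: "t ** t \<notin> range mat" "t ** t ** z = z ** (t ** t)"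
    using scalar_det_1[of "t ** t"] t by (auto simp: mat_centralizer_def det_mul) (metis matrix_mul_assoc)
  have "x ** (t ** t) = (t ** t) ** x"
    using x(3)[of t] t(1) D by (metis (no_types, lifting) matrix_mul_assoc mat2_minus_mult subsetD minus_minus)
  then have "x ** z = z ** x" using commute_trans tt by metis
  then have eq: "mat_centralizer x = mat_centralizer z" using x(2) nz by (rule mat_centralizer_eq)
  \<comment> \<open>An element \<open>d\<close> anticommuting with \<open>x\<close> would make
    \<open>D \<inter> mat_centralizer x\<close> finite, but that set is the whole infinite
    torus.\<close>
  have "d \<in> mat_centralizer z" if d: "d \<in> D" for d
  proof (rule ccontr)
    assume "d \<notin> mat_centralizer z"
    then have "d \<notin> mat_centralizer x" using eq by simp
    then have "d ** x \<noteq> x ** d" using D1[OF d] by (simp add: mat_centralizer_def)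
    then have "x ** d = - (d ** x)" using x(3)[OF d] by metis
    moreover have "trace x = 0" using anticommute_traceless[OF calculation D1[OF d] assms(2)] .
    moreover have "d ** x = - (x ** d)" using calculation by simp
    ultimately have "finite (D \<inter> mat_centralizer x)"
      using nilpotent_anticommute_finite[of D d x] D d assms(2) D1[OF x(1)] by simp
    then show False using D inf eq by (simp add: Int_absorb1)
  qed
  then show "D = mat_centralizer z" using D by blast
qed

section \<open>Centralisers of traceless matrices are Cartan subgroups\<close>

text \<open>Stated for an explicit pair of mutually inverse matrices, so that it applies to inverses
  taken in \<open>SL2\<close> as well as in \<open>GL2\<close>.\<close>

lemma conj_mat_centralizer:
  fixes g h z :: "'k::field^2^2"
  assumes gh: "g ** h = mat 1" "h ** g = mat 1"
  shows "(\<lambda>x. h ** x ** g) ` mat_centralizer z = mat_centralizer (h ** z ** g)"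
proof -
  \<comment> \<open>Kept general in the conjugating pair: the reverse inclusion is the same fact
    with \<open>g\<close> and \<open>h\<close> exchanged.\<close>
  have mem: "h ** x ** g \<in> mat_centralizer (h ** z ** g)"
    if "x \<in> mat_centralizer z" "g ** h = mat 1" "h ** g = mat 1" for x z g h :: "'k^2^2"
  proof -
    have m: "(h ** u ** g) ** (h ** v ** g) = h ** (u ** v) ** g" for u v
    proof -
      have "(h ** u ** g) ** (h ** v ** g) = h ** u ** (g ** h) ** v ** g"
        by (simp only: matrix_mul_assoc)
      then show ?thesis using that(2) by (simp add: matrix_mul_assoc)
    qed
    have "det h * det g = 1" using that(3) by (metis det_I det_mul)
    then have "det (h ** x ** g) = det x" by (simp add: det_mul)
    then show ?thesis using that(1) m[of x z] m[of z x] by (simp add: mat_centralizer_def)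
  qed
  have id: "h ** (g ** x ** h) ** g = x" "g ** (h ** x ** g) ** h = x" for x
  proof -
    have "h ** (g ** x ** h) ** g = (h ** g) ** x ** (h ** g)"
      "g ** (h ** x ** g) ** h = (g ** h) ** x ** (g ** h)"
      by (simp_all only: matrix_mul_assoc)
    then show "h ** (g ** x ** h) ** g = x" "g ** (h ** x ** g) ** h = x" using gh by simp_all
  qed
  show ?thesis
  proof
    show "(\<lambda>x. h ** x ** g) ` mat_centralizer z \<subseteq> mat_centralizer (h ** z ** g)"
      using mem[OF _ gh] by blast
    show "mat_centralizer (h ** z ** g) \<subseteq> (\<lambda>x. h ** x ** g) ` mat_centralizer z"
    proof
      fix y assume "y \<in> mat_centralizer (h ** z ** g)"
      from mem[OF this gh(2,1)] have "g ** y ** h \<in> mat_centralizer z" by (simp only: id)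
      moreover have "y = h ** (g ** y ** h) ** g" by (simp only: id)
      ultimately show "y \<in> (\<lambda>x. h ** x ** g) ` mat_centralizer z" by blast
    qed
  qed
qed

lemma mat_mult_commute: "mat c ** A = A ** mat c" for A :: "'k::field^2^2"
  by (simp add: mat_eq_mat2) (simp add: mat2_eq_iff matrix_matrix_mult_def sum_2 mult.commute)

lemma mat_mult_cancel:
  fixes A :: "'k::field^2^2"
  assumes "mat c ** A = mat d ** A" "A \<noteq> 0"
  shows "c = d"
  using assms by (auto simp: mat_eq_mat2 mat2_eq_iff matrix_matrix_mult_def sum_2)

lemma mat_centralizer_smult:
  fixes z :: "'k::field^2^2"
  assumes "c \<noteq> 0"
  shows "mat_centralizer (mat c ** z) = mat_centralizer z"
proof -
  have "A ** (mat c ** z) = mat c ** z ** A \<longleftrightarrow> A ** z = z ** A" for A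
  proof -
    have "A ** (mat c ** z) = mat c ** (A ** z)" "mat c ** z ** A = mat c ** (z ** A)"
      by (metis mat_mult_commute matrix_mul_assoc)+
    moreover have "mat (inverse c) ** (mat c ** B) = B" for B :: "'k^2^2"
    proof -
      have "mat (inverse c) ** (mat c ** B) = (mat (inverse c) ** mat c) ** B"
        by (simp only: matrix_mul_assoc)
      also have "mat (inverse c) ** mat c = (mat 1 :: 'k^2^2)" using assms by (simp add: mat_eq_mat2)
      finally show ?thesis by simp
    qed
    ultimately show ?thesis by metis
  qed
  then show ?thesis by (simp add: mat_centralizer_def)
qed

section \<open>Normalisers and finite index in general groups\<close>

context group
begin

lemma normalizer_eq:
  assumes "X \<subseteq> carrier G"
  shows "normalizer G X = {g \<in> carrier G. (\<lambda>x. g \<otimes> x \<otimes> inv g) ` X = X}"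
proof -
  have "g <# X #> inv g = (\<lambda>x. g \<otimes> x \<otimes> inv g) ` X" for g
    by (auto simp: l_coset_def r_coset_def)
  then show ?thesis using assms by (auto simp: normalizer_def stabilizer_def)
qed

lemma finite_index_finite_imp_finite:
  assumes "finite_index G X" "finite X"
  shows "finite (carrier G)"
proof -
  have "carrier G = \<Union>(rcosets X)" using assms(1) rcosets_part_G by (auto simp: finite_index_def)
  moreover have "finite Y" if "Y \<in> rcosets X" for Y
    using that assms(2) by (auto simp: RCOSETS_def r_coset_def)
  ultimately show ?thesis using assms(1) by (auto simp: finite_index_def)
qed

end

text \<open>The infinite \<open>X\<close> contains a non-scalar \<open>x\<close>. For
  \<open>g\<close> normalising \<open>X\<close>, the conjugate of \<open>x\<close> by
  \<open>g\<close> commutes both with \<open>z\<close> and with the conjugate of \<open>z\<close>.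
  So these two commute, have equal trace and determinant, and agree up to sign. The normaliser thus
  meets at most two cosets of the torus.\<close>

lemma finite_index_mat_centralizer_normalizer:
  fixes z :: "'k::field^2^2"
  assumes inf: "infinite (UNIV :: 'k set)" and two: "(2::'k) \<noteq> 0" and z: "trace z = 0" "det z \<noteq> 0"
    and X: "finite_index (SL2\<lparr>carrier := mat_centralizer z\<rparr>) X"
  shows "finite_index (SL2\<lparr>carrier := normalizer SL2 X\<rparr>) X"
proof -
  interpret group "SL2 :: ('k^2^2) monoid" by (rule group_SL2)
  let ?C = "SL2\<lparr>carrier := mat_centralizer z\<rparr>"
  have C: "group ?C" by (rule subgroup_imp_group[OF subgroup_mat_centralizer])
  have XC: "X \<subseteq> mat_centralizer z" and finX: "finite (rcosets\<^bsub>?C\<^esub> X)"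
    using X subgroup.subset[of X ?C] by (simp_all add: finite_index_def)
  have sub: "subgroup X SL2"
    using X unfolding finite_index_def by (blast intro: incl_subgroup[OF subgroup_mat_centralizer])
  have "infinite X"
    using group.finite_index_finite_imp_finite[OF C X] infinite_mat_centralizer[OF inf two z] by auto
  then have "\<not> X \<subseteq> {mat 1, - mat 1}" using finite_subset by auto
  then obtain x where x: "x \<in> X" "x \<notin> range mat" "x ** z = z ** x"
    using XC scalar_det_1 by (auto simp: mat_centralizer_def subset_iff)
  have norm: "g ** z = z ** g \<or> g ** z = - (z ** g)" if "g \<in> normalizer SL2 X" for g
  proof -
    have g: "g \<in> carrier SL2" "g \<otimes>\<^bsub>SL2\<^esub> x \<otimes>\<^bsub>SL2\<^esub> inv\<^bsub>SL2\<^esub> g \<in> X"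
      using that x(1) unfolding normalizer_eq[OF subgroup.subset[OF sub]] by blast+
    define h where "h = inv\<^bsub>SL2\<^esub> g"
    have gh: "g ** h = mat 1" "h ** g = mat 1" "det h = 1" "det g = 1"
      using r_inv[OF g(1)] l_inv[OF g(1)] inv_closed[OF g(1)] g(1) by (simp_all add: h_def)
    have "x \<in> mat_centralizer z" using x XC by blast
    then have "g ** x ** h \<in> mat_centralizer (g ** z ** h)"
      using conj_mat_centralizer[OF gh(2,1)] by blast
    then have "(g ** z ** h) ** (g ** x ** h) = (g ** x ** h) ** (g ** z ** h)"
      by (simp add: mat_centralizer_def)
    moreover have "(g ** x ** h) ** z = z ** (g ** x ** h)"
      using g(2) XC by (auto simp: h_def mat_centralizer_def)
    moreover have "g ** x ** h \<notin> range mat"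
    proof
      assume "g ** x ** h \<in> range mat"
      then obtain c where c: "g ** x ** h = mat c" by blast
      have "x = h ** g ** x ** (h ** g)" by (simp add: gh)
      also have "\<dots> = h ** (g ** x ** h) ** g" by (simp only: matrix_mul_assoc)
      also have "\<dots> = mat c ** (h ** g)" unfolding c by (simp only: mat_mult_commute matrix_mul_assoc)
      finally show False using x(2) by (simp add: gh)
    qed
    \<comment> \<open>Transitivity through the non-scalar conjugate
      \<open>g ** x ** h\<close>.\<close>
    ultimately have "(g ** z ** h) ** z = z ** (g ** z ** h)" by (rule commute_trans)
    moreover have "trace (g ** z ** h) = 0"
      using z(1) trace_mul_sym[of "g ** z" h] by (simp add: matrix_mul_assoc gh)
    ultimately have "g ** z ** h = z \<or> g ** z ** h = - z"
      using centralizer_traceless[of "g ** z ** h" z] z two gh by (simp add: det_mul)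
    moreover have "g ** z = g ** z ** h ** g" by (simp add: gh flip: matrix_mul_assoc)
    ultimately show ?thesis by fastforce
  qed
  have cent: "g \<in> mat_centralizer z" if "g \<in> normalizer SL2 X" "g ** z = z ** g" for g
    using that by (auto simp: mat_centralizer_def normalizer_eq[OF subgroup.subset[OF sub]])
  let ?R = "rcosets\<^bsub>?C\<^esub> X"
  have *: "X #>\<^bsub>SL2\<^esub> g \<in> ?R" if "g \<in> mat_centralizer z" for g
    using that by (auto simp: RCOSETS_def r_coset_def)
  have "finite ((\<lambda>g. X #>\<^bsub>SL2\<^esub> g) ` normalizer SL2 X)"
  proof (cases "\<exists>w \<in> normalizer SL2 X. w ** z = - (z ** w)")
    case False
    then have "(\<lambda>g. X #>\<^bsub>SL2\<^esub> g) ` normalizer SL2 X \<subseteq> ?R" using norm cent * by blast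
    then show ?thesis using finX finite_subset by blast
  next
    case True
    then obtain w where w: "w \<in> normalizer SL2 X" "w ** z = - (z ** w)" by blast
    then have wc: "w \<in> carrier SL2" by (simp add: normalizer_eq[OF subgroup.subset[OF sub]])
    define v where "v = inv\<^bsub>SL2\<^esub> w"
    have v: "v ** w = mat 1" "w ** v = mat 1" "det v = 1" "v \<in> carrier SL2"
      using r_inv[OF wc] l_inv[OF wc] inv_closed[OF wc] by (simp_all add: v_def)
    \<comment> \<open>If \<open>g\<close> and \<open>w\<close> both anticommute with
      \<open>z\<close>, then \<open>g ** v\<close> lies in the torus, where \<open>v\<close> is the
      inverse of \<open>w\<close>. So the coset of \<open>g\<close> is the translate by
      \<open>w\<close> of one of the finitely many cosets inside the torus.\<close>
    have "X #>\<^bsub>SL2\<^esub> g \<in> ?R \<union> (\<lambda>Y. Y #>\<^bsub>SL2\<^esub> w) ` ?R" if g: "g \<in> normalizer SL2 X" for g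
    proof (cases "g ** z = z ** g")
      case True
      then show ?thesis using * cent g by blast
    next
      case False
      then have gz: "g ** z = - (z ** g)" using norm g by blast
      have gc: "g \<in> carrier SL2" using g by (simp add: normalizer_eq[OF subgroup.subset[OF sub]])
      have "w ** z ** v = - z" using w(2) v by (simp flip: matrix_mul_assoc)
      then have "v ** (w ** z ** v) = - (v ** z)" by simp
      then have vz: "z ** v = - (v ** z)" by (simp add: matrix_mul_assoc v)
      have "g ** v ** z = - (g ** (z ** v))" by (simp add: vz matrix_mul_assoc)
      also have "\<dots> = z ** (g ** v)" by (simp add: matrix_mul_assoc gz)
      finally have "g ** v \<in> mat_centralizer z" using gc v by (simp add: mat_centralizer_def det_mul)
      from *[OF this] have "(X #>\<^bsub>SL2\<^esub> (g ** v)) #>\<^bsub>SL2\<^esub> w \<in> (\<lambda>Y. Y #>\<^bsub>SL2\<^esub> w) ` ?R" by blast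
      moreover have "(X #>\<^bsub>SL2\<^esub> (g ** v)) #>\<^bsub>SL2\<^esub> w = X #>\<^bsub>SL2\<^esub> g"
      proof -
        have "(X #>\<^bsub>SL2\<^esub> (g \<otimes>\<^bsub>SL2\<^esub> v)) #>\<^bsub>SL2\<^esub> w = X #>\<^bsub>SL2\<^esub> (g \<otimes>\<^bsub>SL2\<^esub> v \<otimes>\<^bsub>SL2\<^esub> w)"
          using gc v(4) wc subgroup.subset[OF sub] by (intro coset_mult_assoc m_closed)
        then show ?thesis using v by (simp flip: matrix_mul_assoc)
      qed
      ultimately show ?thesis by simp
    qed
    then have "(\<lambda>g. X #>\<^bsub>SL2\<^esub> g) ` normalizer SL2 X \<subseteq> ?R \<union> (\<lambda>Y. Y #>\<^bsub>SL2\<^esub> w) ` ?R" by blast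
    then show ?thesis using finX finite_subset by blast
  qed
  moreover have "rcosets\<^bsub>SL2\<lparr>carrier := normalizer SL2 X\<rparr>\<^esub> X = (\<lambda>g. X #>\<^bsub>SL2\<^esub> g) ` normalizer SL2 X"
    by (auto simp: RCOSETS_def r_coset_def)
  moreover have "subgroup X (SL2\<lparr>carrier := normalizer SL2 X\<rparr>)"
    using subgroup_in_normalizer[OF sub] by (simp add: normal_def)
  ultimately show ?thesis by (simp add: finite_index_def)
qed

theorem cartan_mat_centralizer:
  fixes z :: "'k::field^2^2"
  assumes "infinite (UNIV :: 'k set)" "(2::'k) \<noteq> 0" "trace z = 0" "det z \<noteq> 0"
  shows "cartan_subgroup SL2 (mat_centralizer z)"
  using maximal_nilpotent_mat_centralizer[OF assms] finite_index_mat_centralizer_normalizer[OF assms]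
  by (simp add: cartan_subgroup_def)

section \<open>Cartan subgroups are centralisers\<close>

text \<open>A coordinate form of the fact that a diagonal matrix of determinant 1 rescales a
  strictly triangular matrix by the square of a diagonal entry.\<close>

lemma mat2_nilpotent_scaling:
  fixes z :: "'k::field^2^2"
  assumes "trace z = 0" "det z = 0" "c \<noteq> 0"
  obtains g where "det g = 1" "g ** z = mat (c\<^sup>2) ** z ** g"
proof -
  from assms(1) obtain p q r where z: "z = mat2 p q r (- p)" "det z = - (p * p + q * r)"
    by (rule traceless_form)
  then have pqr: "p * p + q * r = 0" using assms(2) by (metis neg_equal_0_iff_equal)
  show thesis
  proof (cases "q = 0")
    case True
    then have "p = 0" using pqr by simp
    then show thesis
      using that[of "mat2 (inverse c) 0 0 c"] True assms(3)
      by (simp add: z mat_eq_mat2 power2_eq_square field_simps)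
  next
    case False
    define e where "e = inverse c"
    have e: "c * e = 1" using assms(3) by (simp add: e_def)
    \<comment> \<open>The vector (q, -p) spans the kernel of \<open>z\<close>; \<open>u\<close>
      makes it an eigenvector of the lower triangular \<open>g\<close> with eigenvalue
      \<open>c\<close>.\<close>
    define u where "u = p * (e - c) / q"
    have u: "u * q = p * (e - c)" using False by (simp add: u_def)
    have eqs: "c * p = c\<^sup>2 * p * c + c\<^sup>2 * q * u" "c * q = c\<^sup>2 * q * e" "u * q - e * p = - (c\<^sup>2 * p * e)"
      using e u by algebra+
    have "q * (u * p + e * r - (c\<^sup>2 * r * c - c\<^sup>2 * p * u)) = 0"
      using e u pqr by algebra
    then have "u * p + e * r = c\<^sup>2 * r * c - c\<^sup>2 * p * u" using False by simp
    with eqs show thesis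
      using that[of "mat2 c 0 u e"] e by (simp add: z mat_eq_mat2)
  qed
qed

text \<open>This rules out the unipotent case. The matrices scaling \<open>z\<close> by nonzero
  squares normalise its centraliser, and two in the same coset scale \<open>z\<close> by the same
  square. As squaring in \<open>K\<close> is at most two-to-one, there are infinitely many
  cosets.\<close>

lemma not_finite_index_nilpotent:
  fixes z :: "'k::field^2^2"
  assumes inf: "infinite (UNIV :: 'k set)" and z: "trace z = 0" "det z = 0" "z \<noteq> 0"
  shows "\<not> finite_index (SL2\<lparr>carrier := normalizer SL2 (mat_centralizer z)\<rparr>) (mat_centralizer z)"
proof
  interpret group "SL2 :: ('k^2^2) monoid" by (rule group_SL2)
  let ?C = "mat_centralizer z"
  assume fin: "finite_index (SL2\<lparr>carrier := normalizer SL2 ?C\<rparr>) ?C"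
  have "\<forall>c. \<exists>g. c \<noteq> 0 \<longrightarrow> det g = 1 \<and> g ** z = mat (c\<^sup>2) ** z ** g"
    using mat2_nilpotent_scaling[OF z(1,2)] by metis
  then obtain g where g: "\<And>c. c \<noteq> 0 \<Longrightarrow> det (g c) = 1" "\<And>c. c \<noteq> 0 \<Longrightarrow> g c ** z = mat (c\<^sup>2) ** z ** g c"
    by metis
  have norm: "g c \<in> normalizer SL2 ?C" if "c \<noteq> 0" for c
  proof -
    have gc: "g c \<in> carrier SL2" using g(1)[OF that] by simp
    define h where "h = inv\<^bsub>SL2\<^esub> (g c)"
    have gh: "g c ** h = mat 1" "h ** g c = mat 1"
      using r_inv[OF gc] l_inv[OF gc] by (simp_all add: h_def)
    have "(\<lambda>x. g c ** x ** h) ` ?C = mat_centralizer (g c ** z ** h)"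
      by (rule conj_mat_centralizer[OF gh(2,1)])
    also have "g c ** z ** h = mat (c\<^sup>2) ** z" using g(2)[OF that] by (simp add: gh flip: matrix_mul_assoc)
    also have "mat_centralizer (mat (c\<^sup>2) ** z) = ?C" using that by (intro mat_centralizer_smult) simp
    finally show ?thesis
      using gc subgroup.subset[OF subgroup_mat_centralizer] by (subst normalizer_eq) (auto simp: h_def)
  qed
  \<comment> \<open>The two matrices differ by a left factor \<open>a\<close> centralising
    \<open>z\<close>, so both scalings apply to the same nonzero product \<open>z ** g c\<close>,
    and the scalars can be compared.\<close>
  have sq: "c\<^sup>2 = d\<^sup>2" if cd: "c \<noteq> 0" "d \<noteq> 0" and eq: "?C #>\<^bsub>SL2\<^esub> g c = ?C #>\<^bsub>SL2\<^esub> g d" for c d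
  proof -
    have "g c \<in> ?C #>\<^bsub>SL2\<^esub> g d"
      using rcos_self[OF _ subgroup_mat_centralizer, of "g c" z] g(1)[OF cd(1)] eq by simp
    then obtain a where a: "a \<in> ?C" "g c = a ** g d" by (auto simp: r_coset_def)
    have "mat (c\<^sup>2) ** (z ** g c) = g c ** z" using g(2)[OF cd(1)] by (simp add: matrix_mul_assoc)
    also have "\<dots> = a ** (mat (d\<^sup>2) ** z ** g d)"
      using g(2)[OF cd(2)] by (simp add: a(2) flip: matrix_mul_assoc)
    also have "\<dots> = (a ** mat (d\<^sup>2)) ** z ** g d" by (simp only: matrix_mul_assoc)
    also have "\<dots> = mat (d\<^sup>2) ** (a ** z) ** g d" by (simp only: mat_mult_commute[symmetric] matrix_mul_assoc)
    also have "\<dots> = mat (d\<^sup>2) ** (z ** g c)" using a by (simp add: mat_centralizer_def matrix_mul_assoc)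
    finally have eq: "mat (c\<^sup>2) ** (z ** g c) = mat (d\<^sup>2) ** (z ** g c)" .
    have "z ** g c \<noteq> 0"
    proof
      assume "z ** g c = 0"
      moreover have "g c \<in> carrier SL2" using g(1)[OF cd(1)] by simp
      then have "z = z ** g c ** inv\<^bsub>SL2\<^esub> (g c)" using r_inv[of "g c"] by (simp flip: matrix_mul_assoc)
      ultimately show False using z(3) by (simp add: mat2_eq_iff matrix_matrix_mult_def sum_2)
    qed
    with eq show "c\<^sup>2 = d\<^sup>2" by (rule mat_mult_cancel)
  qed
  have "(\<lambda>c. ?C #>\<^bsub>SL2\<^esub> g c) ` (UNIV - {0}) \<subseteq> rcosets\<^bsub>SL2\<lparr>carrier := normalizer SL2 ?C\<rparr>\<^esub> ?C"
    using norm by (auto simp: RCOSETS_def r_coset_def)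
  then have "finite ((\<lambda>c. ?C #>\<^bsub>SL2\<^esub> g c) ` (UNIV - {0}))"
    using fin finite_subset by (auto simp: finite_index_def)
  moreover have "infinite (UNIV - {0 :: 'k})" using inf by simp
  ultimately obtain d where d: "d \<noteq> 0" "infinite {c \<in> UNIV - {0}. ?C #>\<^bsub>SL2\<^esub> g c = ?C #>\<^bsub>SL2\<^esub> g d}"
    using pigeonhole_infinite[of "UNIV - {0}" "\<lambda>c. ?C #>\<^bsub>SL2\<^esub> g c"] by blast
  have "{c \<in> UNIV - {0}. ?C #>\<^bsub>SL2\<^esub> g c = ?C #>\<^bsub>SL2\<^esub> g d} \<subseteq> {d, - d}"
    using sq[OF _ d(1)] by (auto simp: power2_eq_iff)
  with d(2) show False using finite_subset by blast
qed

lemma (in group) finite_index_self: "finite_index G (carrier G)"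
proof -
  have "rcosets (carrier G) \<subseteq> {carrier G}"
    using coset_join2[OF _ subgroup_self] by (auto simp: RCOSETS_def)
  then show ?thesis using subgroup_self finite_subset by (auto simp: finite_index_def)
qed

text \<open>In a finite \<open>C\<close> the trivial subgroup has finite index, but its normaliser
  is the whole infinite group.\<close>

lemma (in group) cartan_subgroup_infinite:
  assumes "infinite (carrier G)" "cartan_subgroup G C"
  shows "infinite C"
proof
  assume fin: "finite C"
  have sub: "subgroup C G"
    using assms(2) by (simp add: cartan_subgroup_def maximal_nilpotent_subgroup_def nilpotent_subgroup_def)
  interpret C: group "G\<lparr>carrier := C\<rparr>" using sub by (rule subgroup_imp_group)
  have "finite_index (G\<lparr>carrier := C\<rparr>) {\<one>}"
    using fin C.triv_subgroup by (auto simp: finite_index_def RCOSETS_def)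
  then have "finite_index (G\<lparr>carrier := normalizer G {\<one>}\<rparr>) {\<one>}"
    using assms(2) by (simp add: cartan_subgroup_def)
  moreover have "normalizer G {\<one>} = carrier G" by (auto simp: normalizer_eq)
  ultimately show False using finite_index_finite_imp_finite[of "{\<one>}"] assms(1) by simp
qed

text \<open>By maximality \<open>C\<close> is the centraliser of a non-scalar \<open>x\<close>, once
  anticommuting elements are excluded. Subtracting half the trace of \<open>x\<close> gives a
  traceless \<open>z\<close>, and its determinant is nonzero by the finite index condition applied
  to \<open>C\<close> itself.\<close>

theorem cartan_subgroup_SL2_obtain:
  fixes C :: "('k::field^2^2) set"
  assumes inf: "infinite (UNIV :: 'k set)" and two: "(2::'k) \<noteq> 0" and C: "cartan_subgroup SL2 C"
  obtains z where "trace z = 0" "det z \<noteq> 0" "C = mat_centralizer z"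
proof -
  interpret group "SL2 :: ('k^2^2) monoid" by (rule group_SL2)
  have nil: "nilpotent_subgroup SL2 C"
    and max: "\<And>D. nilpotent_subgroup SL2 D \<Longrightarrow> C \<subseteq> D \<Longrightarrow> D = C"
    using C by (simp_all add: cartan_subgroup_def maximal_nilpotent_subgroup_def)
  have sub: "subgroup C SL2" using nil by (simp add: nilpotent_subgroup_def)
  have det1: "det d = 1" if "d \<in> C" for d using subgroup.mem_carrier[OF sub that] by simp
  have "infinite (mat_centralizer (mat2 0 1 1 0 :: 'k^2^2))"
    using inf two by (intro infinite_mat_centralizer) simp_all
  then have "infinite (carrier (SL2 :: ('k^2^2) monoid))"
    using subgroup.subset[OF subgroup_mat_centralizer] finite_subset by blast
  then have infC: "infinite C" using cartan_subgroup_infinite[OF _ C] by blast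
  from nilpotent_subgroup_SL2_obtain[OF nil this]
  obtain x where x: "x \<in> C" "x \<notin> range mat"
    "\<And>d. d \<in> C \<Longrightarrow> x ** d = d ** x \<or> x ** d = - (d ** x)" by metis
  have comm: "x ** w = w ** x" if w: "w \<in> C" for w
  proof (rule ccontr)
    assume "x ** w \<noteq> w ** x"
    then have xw: "x ** w = - (w ** x)" using x(3)[OF w] by blast
    then have wx: "w ** x = - (x ** w)" by simp
    have "trace x = 0" using anticommute_traceless[OF xw det1[OF w] two] .
    then have fin: "finite (C \<inter> mat_centralizer x)"
      using nilpotent_anticommute_finite[OF nil w wx] det1[OF x(1)] two by simp
    \<comment> \<open>Two elements anticommuting with \<open>x\<close> differ by one commuting with
      it, so \<open>C\<close> is covered by two translates of a finite set.\<close>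
    have "C \<subseteq> (C \<inter> mat_centralizer x) \<union> (\<lambda>t. t ** w) ` (C \<inter> mat_centralizer x)"
    proof
      fix d assume d: "d \<in> C"
      show "d \<in> (C \<inter> mat_centralizer x) \<union> (\<lambda>t. t ** w) ` (C \<inter> mat_centralizer x)"
      proof (cases "x ** d = d ** x")
        case True
        then show ?thesis using d det1[OF d] by (simp add: mat_centralizer_def)
      next
        case False
        then have xd: "x ** d = - (d ** x)" using x(3)[OF d] by blast
        define v where "v = inv\<^bsub>SL2\<^esub> w"
        have v: "v \<in> C" unfolding v_def using subgroup.m_inv_closed[OF sub w] .
        have wv: "w ** v = mat 1" "v ** w = mat 1"
          using r_inv[of w] l_inv[of w] det1[OF w] by (simp_all add: v_def)
        have "v ** (w ** x) ** v = - (v ** (x ** w) ** v)" using wx by simp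
        then have xv: "x ** v = - (v ** x)"
          by (simp add: matrix_mul_assoc wv) (simp add: wv flip: matrix_mul_assoc)
        have "d ** v ** x = - (d ** (x ** v))" by (simp add: xv matrix_mul_assoc)
        also have "\<dots> = x ** (d ** v)" by (simp add: matrix_mul_assoc xd)
        finally have "d ** v \<in> C \<inter> mat_centralizer x"
          using det1[OF d] det1[OF v] subgroup.m_closed[OF sub d v] by (simp add: mat_centralizer_def det_mul)
        moreover have "d = d ** v ** w" by (simp add: wv flip: matrix_mul_assoc)
        ultimately show ?thesis by blast
      qed
    qed
    with fin have "finite C" using finite_subset by blast
    with infC show False ..
  qed
  have Cx: "C = mat_centralizer x"
  proof -
    have "C \<subseteq> mat_centralizer x" using comm det1 by (simp add: subset_iff mat_centralizer_def)
    then show ?thesis using max[OF nilpotent_subgroup_mat_centralizer[OF x(2)]] by simp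
  qed
  obtain a b c d where xm: "x = mat2 a b c d" by (rule mat2_exhaust)
  \<comment> \<open>The diagonal of \<open>x\<close> minus half its trace is \<open>p\<close>,
    \<open>- p\<close>.\<close>
  define p where "p = (a - d) / 2"
  have p: "2 * p = a - d" using two by (simp add: p_def)
  define z where "z = mat2 p b c (- p)"
  have nz: "z \<notin> range mat"
  proof
    assume "z \<in> range mat"
    then have "b = 0" "c = 0" "p = - p" by (auto simp: z_def mat_eq_mat2)
    moreover from this(3) have "2 * p = 0" by algebra
    ultimately show False using x(2) p by (auto simp: xm mat_eq_mat2)
  qed
  have "x ** z = z ** x"
    unfolding xm z_def mat2_mult mat2_inject using p
    by (intro conjI; (algebra | simp))
  then have Cz: "C = mat_centralizer z" using mat_centralizer_eq[OF _ x(2) nz] Cx by simp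
  have tr: "trace z = 0" by (simp add: z_def)
  have "det z \<noteq> 0"
  proof
    assume "det z = 0"
    moreover have "z \<noteq> 0" using nz by (auto simp: mat_eq_mat2 mat2_eq_iff image_iff)
    ultimately have "\<not> finite_index (SL2\<lparr>carrier := normalizer SL2 C\<rparr>) C"
      using not_finite_index_nilpotent[OF inf tr] by (simp add: Cz)
    moreover have "finite_index (SL2\<lparr>carrier := C\<rparr>) C"
      using group.finite_index_self[OF subgroup_imp_group[OF sub]] by simp
    ultimately show False using C by (simp add: cartan_subgroup_def)
  qed
  with tr Cz show thesis using that by blast
qed

section \<open>Conjugation\<close>

lemma GL2_simps [simp]:
  "x \<otimes>\<^bsub>GL2\<^esub> y = x ** y" "\<one>\<^bsub>GL2\<^esub> = mat 1" "x \<in> carrier GL2 \<longleftrightarrow> det x \<noteq> 0"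
  by (simp_all add: GL2_def invertible_det_nz)

text \<open>The matrix \<open>mat2 0 1 \<delta> 0\<close> squares to \<delta>, and the elements of
  \<open>Q \<delta>\<close> are the a + b z of norm 1 over this z.\<close>

lemma Q_eq_mat_centralizer: "Q \<delta> = mat_centralizer (mat2 0 1 \<delta> 0)"
proof (intro subset_antisym subsetI)
  fix A assume "A \<in> Q \<delta>"
  then show "A \<in> mat_centralizer (mat2 0 1 \<delta> 0)"
    by (auto simp: Q_def mat_centralizer_def mult.commute)
next
  fix A :: "'a^2^2" assume A: "A \<in> mat_centralizer (mat2 0 1 \<delta> 0)"
  obtain a b c d where m: "A = mat2 a b c d" by (rule mat2_exhaust)
  from A have "c = b * \<delta>" "d = a" "a * d - b * c = 1" by (auto simp: m mat_centralizer_def)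
  then show "A \<in> Q \<delta>" by (auto simp: m Q_def power2_eq_square mult.assoc)
qed

text \<open>Away from characteristic 2 the two eigenvalues 1 and -1 are distinct, so only diagonal
  matrices commute.\<close>

lemma Q1_eq_mat_centralizer:
  assumes "(2::'k::field) \<noteq> 0"
  shows "Q1 = mat_centralizer (mat2 1 0 0 (- 1) :: 'k^2^2)"
proof (intro subset_antisym subsetI)
  fix A :: "'k^2^2" assume "A \<in> Q1"
  then show "A \<in> mat_centralizer (mat2 1 0 0 (- 1))"
    by (auto simp: Q1_def mat_centralizer_def)
next
  fix A :: "'k^2^2" assume A: "A \<in> mat_centralizer (mat2 1 0 0 (- 1))"
  obtain a b c d where m: "A = mat2 a b c d" by (rule mat2_exhaust)
  from A have "- b = b" "c = - c" and ad: "a * d - b * c = 1" by (auto simp: m mat_centralizer_def)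
  then have "2 * b = 0" "2 * c = 0" by (metis add.right_inverse mult_2)+
  then have "b = 0" "c = 0" using assms by auto
  with ad show "A \<in> Q1" by (auto simp: m Q1_def intro: inverse_unique[symmetric])
qed

lemma conj_set_mat_centralizer:
  assumes "g \<in> carrier GL2"
  shows "conj_set GL2 (mat_centralizer z) g = mat_centralizer (inv\<^bsub>GL2\<^esub> g ** z ** g)"
proof -
  interpret group "GL2 :: ('a^2^2) monoid" by (rule group_GL2)
  show ?thesis
    using conj_mat_centralizer[of g "inv\<^bsub>GL2\<^esub> g" z] r_inv[OF assms] l_inv[OF assms]
    by (simp add: conj_set_def)
qed

lemma conj_set_SL2:
  assumes "g \<in> carrier SL2"
  shows "conj_set SL2 S g = conj_set GL2 S g"
proof -
  have "inv\<^bsub>SL2\<^esub> g = inv\<^bsub>GL2\<^esub> g"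
    using group.m_inv_consistent[OF group_GL2 subgroup_SL2_GL2 assms] by (metis SL2_eq)
  then show ?thesis by (simp add: conj_set_def)
qed

section \<open>Composition of conjugations and conjugacy classes\<close>

context group
begin

lemma conj_set_conj_set:
  assumes "S \<subseteq> carrier G" "a \<in> carrier G" "b \<in> carrier G"
  shows "conj_set G (conj_set G S a) b = conj_set G S (a \<otimes> b)"
  unfolding conj_set_def image_image
  using assms by (intro image_cong) (auto simp: inv_mult_group m_assoc)

lemma conj_class_conj_set:
  assumes "S \<subseteq> carrier G" "g \<in> carrier G"
  shows "conj_class G (conj_set G S g) = conj_class G S"
proof -
  have "conj_class G (conj_set G S g) = (\<lambda>k. conj_set G S (g \<otimes> k)) ` carrier G"
    unfolding conj_class_def using assms by (intro image_cong) (auto simp: conj_set_conj_set)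
  also have "\<dots> = conj_set G S ` (\<lambda>k. g \<otimes> k) ` carrier G" by (simp add: image_image)
  also have "(\<lambda>k. g \<otimes> k) ` carrier G = carrier G"
    using surj_const_mult[OF assms(2)] .
  finally show ?thesis by (simp add: conj_class_def)
qed

end

lemma mat_centralizer_subset_SL2: "mat_centralizer z \<subseteq> carrier SL2"
  by (auto simp: mat_centralizer_def)

lemma mat_centralizer_subset_GL2: "mat_centralizer z \<subseteq> carrier GL2"
  by (auto simp: mat_centralizer_def)

lemma det_mat: "det (mat c :: 'k::field^2^2) = c\<^sup>2"
  by (simp add: mat_eq_mat2 power2_eq_square)

text \<open>Scalars are central, so conjugation allows det g to be changed by any nonzero square;
  this is how square classes enter the passage from \<open>GL2\<close> to
  \<open>SL2\<close>.\<close>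

lemma conj_set_smult:
  fixes g :: "'k::field^2^2"
  assumes "g \<in> carrier GL2" "c \<noteq> 0"
  shows "conj_set GL2 S (mat c ** g) = conj_set GL2 S g"
proof -
  interpret group "GL2 :: ('k^2^2) monoid" by (rule group_GL2)
  define h where "h = inv\<^bsub>GL2\<^esub> g"
  have gh: "h ** g = mat 1" "det h \<noteq> 0"
    using l_inv[OF assms(1)] inv_closed[OF assms(1)] by (simp_all add: h_def)
  have ic: "mat (inverse c) ** mat c = (mat 1 :: 'k^2^2)" using assms(2) by (simp add: mat_eq_mat2)
  have "inv\<^bsub>GL2\<^esub> (mat c ** g) = mat (inverse c) ** h"
  proof (rule inv_equality)
    have "mat (inverse c) ** h ** (mat c ** g) = mat (inverse c) ** (h ** mat c) ** g"
      by (simp only: matrix_mul_assoc)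
    also have "\<dots> = mat (inverse c) ** mat c ** (h ** g)"
      unfolding mat_mult_commute[of c h, symmetric] by (simp only: matrix_mul_assoc)
    finally show "mat (inverse c) ** h \<otimes>\<^bsub>GL2\<^esub> (mat c ** g) = \<one>\<^bsub>GL2\<^esub>" by (simp add: ic gh)
  qed (use assms gh in \<open>simp_all add: det_mul det_mat\<close>)
  moreover have "mat (inverse c) ** h ** x ** (mat c ** g) = h ** x ** g" for x
  proof -
    have "mat (inverse c) ** h ** x ** (mat c ** g) = mat (inverse c) ** ((h ** x) ** mat c) ** g"
      by (simp only: matrix_mul_assoc)
    also have "\<dots> = mat (inverse c) ** mat c ** (h ** x ** g)"
      unfolding mat_mult_commute[of c "h ** x", symmetric] by (simp only: matrix_mul_assoc)
    finally show ?thesis by (simp add: ic)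
  qed
  ultimately show ?thesis by (simp add: conj_set_def h_def)
qed

text \<open>Take \<open>g\<close> with rows v and v z for a row vector v = (x, y) that is not an
  eigenvector of \<open>z\<close>. Since z z = - det z, multiplying \<open>g\<close> by
  \<open>z\<close> on the right acts on these rows as the companion matrix does on the left.\<close>

lemma traceless_conj_companion:
  fixes z :: "'k::field^2^2"
  assumes "(2::'k) \<noteq> 0" "trace z = 0" "det z \<noteq> 0"
  obtains g where "g \<in> carrier GL2" "z = inv\<^bsub>GL2\<^esub> g ** mat2 0 1 (- det z) 0 ** g"
proof -
  interpret group "GL2 :: ('k^2^2) monoid" by (rule group_GL2)
  from assms(2) obtain p q r where z: "z = mat2 p q r (- p)" "det z = - (p * p + q * r)"
    by (rule traceless_form)
  have row: "mat2 x y (x * p + y * r) (x * q - y * p) ** z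
      = mat2 0 1 (- det z) 0 ** mat2 x y (x * p + y * r) (x * q - y * p)" for x y
    unfolding z(2) unfolding z(1) mat2_mult mat2_inject by (intro conjI; algebra)
  \<comment> \<open>The expression is det g. If it vanished for (1, 0), (0, 1) and (1, 1), then q, r
    and 2 p would be 0.\<close>
  have "\<exists>x y. x * (x * q - y * p) - y * (x * p + y * r) \<noteq> 0"
  proof (rule ccontr)
    assume "\<not> ?thesis"
    then have *: "\<And>x y. x * (x * q - y * p) - y * (x * p + y * r) = 0" by blast
    have "q = 0" "r = 0" using *[of 1 0] *[of 0 1] by simp_all
    moreover have "2 * p = 0" using *[of 1 1] calculation by simp
    ultimately show False using assms(1,3) z(2) by simp
  qed
  then obtain x y where xy: "x * (x * q - y * p) - y * (x * p + y * r) \<noteq> 0" by blast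
  define g where "g = mat2 x y (x * p + y * r) (x * q - y * p)"
  have g: "g \<in> carrier GL2" using xy by (simp add: g_def)
  have "inv\<^bsub>GL2\<^esub> g ** mat2 0 1 (- det z) 0 ** g = inv\<^bsub>GL2\<^esub> g ** (g ** z)"
    using row[of x y] by (simp add: g_def flip: matrix_mul_assoc)
  also have "\<dots> = z" using l_inv[OF g] by (simp add: matrix_mul_assoc)
  finally show thesis using that[OF g] by simp
qed

lemma mat_centralizer_conj_Q:
  fixes z :: "'k::field^2^2"
  assumes "(2::'k) \<noteq> 0" "trace z = 0" "det z \<noteq> 0"
  obtains g where "g \<in> carrier GL2" "mat_centralizer z = conj_set GL2 (Q (- det z)) g"
proof -
  from assms obtain g where g: "g \<in> carrier GL2" "z = inv\<^bsub>GL2\<^esub> g ** mat2 0 1 (- det z) 0 ** g"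
    by (rule traceless_conj_companion)
  show thesis
    using that[OF g(1)] g(2) conj_set_mat_centralizer[OF g(1)] by (simp add: Q_eq_mat_centralizer)
qed

lemma traceless_conj:
  fixes z :: "'k::field^2^2"
  assumes "trace z = 0" "g \<in> carrier GL2"
  shows "trace (inv\<^bsub>GL2\<^esub> g ** z ** g) = 0" "det (inv\<^bsub>GL2\<^esub> g ** z ** g) = det z"
proof -
  interpret group "GL2 :: ('k^2^2) monoid" by (rule group_GL2)
  have gh: "g ** inv\<^bsub>GL2\<^esub> g = mat 1" using r_inv[OF assms(2)] by simp
  show "trace (inv\<^bsub>GL2\<^esub> g ** z ** g) = 0"
    using assms(1) trace_mul_sym[of "inv\<^bsub>GL2\<^esub> g" "z ** g"] by (simp add: gh flip: matrix_mul_assoc)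
  have "det g * det (inv\<^bsub>GL2\<^esub> g) = 1" using gh by (metis det_I det_mul)
  then show "det (inv\<^bsub>GL2\<^esub> g ** z ** g) = det z" by (simp add: det_mul mult.commute mult.left_commute)
qed

text \<open>Rescaled to determinant -1, \<open>z\<close> has the same companion form as diag(1, -1),
  so its centraliser is a \<open>GL2\<close>-conjugate of \<open>Q1\<close>. Diagonal matrices fix
  \<open>Q1\<close> and have every nonzero determinant, which brings the conjugating matrix into
  \<open>SL2\<close>. Here \<open>Q 1\<close> is the family \<open>Q \<delta>\<close> at \<delta> =
  1, not the diagonal group \<open>Q1\<close>.\<close>

lemma mat_centralizer_split_conj_Q1:
  fixes z :: "'k::field^2^2"
  assumes two: "(2::'k) \<noteq> 0" and z: "trace z = 0" "- det z = c\<^sup>2" "c \<noteq> 0"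
  obtains g where "g \<in> carrier SL2" "mat_centralizer z = conj_set SL2 Q1 g"
proof -
  interpret group "GL2 :: ('k^2^2) monoid" by (rule group_GL2)
  define y where "y = mat (inverse c) ** z"
  have y: "trace y = 0" "det y = - 1"
  proof -
    obtain p q r where zm: "z = mat2 p q r (- p)" using z(1) by (rule traceless_form)
    show "trace y = 0" by (simp add: y_def zm mat_eq_mat2)
    have "det z = - (c\<^sup>2)" using z(2) by (metis minus_minus)
    then show "det y = - 1" using z(3) by (simp add: y_def det_mul det_mat field_simps)
  qed
  have Cy: "mat_centralizer y = mat_centralizer z"
    unfolding y_def using z(3) by (intro mat_centralizer_smult) simp
  let ?D = "mat2 1 0 0 (- 1) :: 'k^2^2"
  obtain g where g: "g \<in> carrier GL2" "mat_centralizer y = conj_set GL2 (Q 1) g"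
    using mat_centralizer_conj_Q[OF two y(1)] unfolding y(2) minus_minus by (metis neg_equal_0_iff_equal one_neq_zero)
  have D: "trace ?D = 0" "det ?D \<noteq> 0" "- det ?D = 1" by simp_all
  obtain h :: "'k^2^2" where h: "h \<in> carrier GL2" "Q1 = conj_set GL2 (Q 1) h"
    using mat_centralizer_conj_Q[OF two D(1,2)] unfolding D(3) Q1_eq_mat_centralizer[OF two] by blast
  have QG: "Q 1 \<subseteq> carrier GL2" "Q1 \<subseteq> carrier (GL2 :: ('k^2^2) monoid)"
    unfolding Q_eq_mat_centralizer Q1_eq_mat_centralizer[OF two] by (rule mat_centralizer_subset_GL2)+
  define k where "k = inv\<^bsub>GL2\<^esub> h \<otimes>\<^bsub>GL2\<^esub> g"
  have k: "k \<in> carrier GL2" using g h unfolding k_def by (intro m_closed inv_closed)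
  have "h \<otimes>\<^bsub>GL2\<^esub> k = g"
    unfolding k_def using g h m_assoc[of h "inv\<^bsub>GL2\<^esub> h" g] inv_closed[OF h(1)] r_inv[OF h(1)] l_one[OF g(1)]
    by (simp del: GL2_simps)
  then have Qk: "conj_set GL2 Q1 k = mat_centralizer z"
    using conj_set_conj_set[OF QG(1) h(1) k] g(2) h(2) Cy by simp
  \<comment> \<open>A diagonal matrix chosen to cancel the determinant of \<open>k\<close>.\<close>
  define t where "t = mat2 (inverse (det k)) 0 0 1"
  have t: "t \<in> carrier GL2" using k by (simp add: t_def)
  have "inv\<^bsub>GL2\<^esub> t ** ?D ** t = ?D"
  proof -
    have "?D ** t = t ** ?D" by (simp add: t_def)
    then have "inv\<^bsub>GL2\<^esub> t ** ?D ** t = inv\<^bsub>GL2\<^esub> t ** t ** ?D" by (simp flip: matrix_mul_assoc)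
    then show ?thesis using l_inv[OF t] by simp
  qed
  then have "conj_set GL2 Q1 t = Q1"
    using conj_set_mat_centralizer[OF t] by (simp add: Q1_eq_mat_centralizer[OF two])
  then have "conj_set GL2 Q1 (t \<otimes>\<^bsub>GL2\<^esub> k) = mat_centralizer z"
    using conj_set_conj_set[OF QG(2) t k] Qk by simp
  moreover have "t \<otimes>\<^bsub>GL2\<^esub> k \<in> carrier SL2" using k by (simp add: det_mul t_def)
  ultimately show thesis using that conj_set_SL2 by metis
qed

section \<open>Square classes and the classification\<close>

definition square_class :: "'k::field \<Rightarrow> 'k set" where
  "square_class x = nonzero_squares #>\<^bsub>mult_group\<^esub> x"

lemma mem_square_class: "y \<in> square_class x \<longleftrightarrow> (\<exists>s. s \<noteq> 0 \<and> y = s\<^sup>2 * x)"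
  by (auto simp: square_class_def r_coset_def nonzero_squares_def mult_group_def)

lemma carrier_Mod_nonzero_squares:
  "carrier (mult_group Mod nonzero_squares) = square_class ` (UNIV - {0})"
  by (auto simp: FactGroup_def RCOSETS_def square_class_def mult_group_def)

lemma square_class_subset:
  assumes "y \<in> square_class x"
  shows "square_class y \<subseteq> square_class x"
proof
  fix z assume "z \<in> square_class y"
  then obtain s t where "s \<noteq> 0" "t \<noteq> 0" "z = s\<^sup>2 * (t\<^sup>2 * x)"
    using assms by (auto simp: mem_square_class)
  then show "z \<in> square_class x"
    unfolding mem_square_class by (intro exI[of _ "s * t"]) (simp add: power_mult_distrib)
qed

lemma square_class_sym:
  assumes "y \<in> square_class x"
  shows "x \<in> square_class y"
proof -
  obtain s where "s \<noteq> 0" "y = s\<^sup>2 * x" using assms by (auto simp: mem_square_class)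
  then have "inverse s \<noteq> 0 \<and> x = (inverse s)\<^sup>2 * y" by (simp add: field_simps)
  then show ?thesis unfolding mem_square_class ..
qed

lemma square_class_eq: "y \<in> square_class x \<Longrightarrow> square_class y = square_class x"
  using square_class_subset[of y x] square_class_subset[of x y] square_class_sym[of y x] by blast

lemma square_class_self: "x \<in> square_class x"
  unfolding mem_square_class by (intro exI[of _ 1]) simp

lemma nonzero_squares_eq: "nonzero_squares = square_class 1"
  by (auto simp: mem_square_class nonzero_squares_def mult_group_def)

text \<open>Used with x = - det z: replacing \<open>z\<close> by s z keeps the centraliser and moves
  - det z into \<open>R\<close>.\<close>

lemma nonsquare_reps_obtain:
  fixes x :: "'k::field"
  assumes "nonsquare_reps R" "x \<noteq> 0" "x \<notin> nonzero_squares"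
  obtains s where "s \<noteq> 0" "s\<^sup>2 * x \<in> R"
proof -
  have "square_class x \<noteq> nonzero_squares" using square_class_self[of x] assms(3) by blast
  moreover have "square_class x \<in> carrier (mult_group Mod nonzero_squares)"
    unfolding carrier_Mod_nonzero_squares using assms(2) by blast
  ultimately obtain d where "d \<in> R \<inter> square_class x" using assms(1) unfolding nonsquare_reps_def by blast
  then show thesis using that by (auto simp: mem_square_class)
qed

text \<open>Uniqueness of representatives makes \<open>R\<close> inject into the finite quotient by
  the squares.\<close>

lemma nonsquare_reps_finite:
  fixes R :: "'k::field set"
  assumes "nonsquare_reps R" "finite (carrier ((mult_group :: 'k monoid) Mod nonzero_squares))"
  shows "finite R"
proof -
  have R: "R \<subseteq> carrier mult_group - nonzero_squares"
    and uniq: "\<And>c. c \<in> carrier (mult_group Mod nonzero_squares) - {nonzero_squares} \<Longrightarrow> \<exists>!\<delta>. \<delta> \<in> R \<inter> c"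
    using assms(1) unfolding nonsquare_reps_def by blast+
  have nontriv: "square_class x \<in> carrier (mult_group Mod nonzero_squares) - {nonzero_squares}" if "x \<in> R" for x
  proof -
    have "square_class x \<noteq> nonzero_squares" using square_class_self[of x] R that by blast
    moreover have "x \<noteq> 0" using R that by (auto simp: mult_group_def)
    ultimately show ?thesis unfolding carrier_Mod_nonzero_squares by blast
  qed
  have "inj_on square_class R"
  proof (rule inj_onI)
    fix x y assume xy: "x \<in> R" "y \<in> R" "square_class x = square_class y"
    define c where "c = square_class x"
    have "x \<in> c" "y \<in> c"
      using square_class_self[of x] square_class_self[of y] unfolding c_def by (simp_all only: xy(3))
    moreover have "\<exists>!\<delta>. \<delta> \<in> R \<inter> c" unfolding c_def by (rule uniq[OF nontriv[OF xy(1)]])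
    ultimately show "x = y" using xy(1,2) by blast
  qed
  moreover have "square_class ` R \<subseteq> carrier (mult_group Mod nonzero_squares)" using nontriv by blast
  ultimately show ?thesis using assms(2) by (rule inj_on_finite)
qed

lemma nonsquare_reps_exists: "\<exists>R :: 'k::field set. nonsquare_reps R"
proof -
  define R where "R = (\<lambda>c. SOME y. y \<in> c) `
    (carrier ((mult_group :: 'k monoid) Mod nonzero_squares) - {nonzero_squares})"
  have some: "\<exists>x. x \<noteq> 0 \<and> c = square_class x \<and> (SOME y. y \<in> c) \<in> c"
    if "c \<in> carrier (mult_group Mod nonzero_squares)" for c
  proof -
    obtain x where x: "x \<noteq> 0" "c = square_class x" using \<open>c \<in> _\<close> unfolding carrier_Mod_nonzero_squares by blast
    then have "x \<in> c" using square_class_self by blast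
    then have "(SOME y. y \<in> c) \<in> c" by (rule someI[of "\<lambda>y. y \<in> c"])
    with x show ?thesis by blast
  qed
  have "nonsquare_reps R" unfolding nonsquare_reps_def
  proof (intro conjI ballI subsetI)
    fix y assume "y \<in> R"
    then obtain c where c: "c \<in> carrier ((mult_group :: 'k monoid) Mod nonzero_squares)"
      "c \<noteq> nonzero_squares" "y = (SOME y. y \<in> c)"
      by (auto simp: R_def)
    from some[OF c(1)] obtain x where x: "x \<noteq> 0" "c = square_class x" "y \<in> c" using c(3) by blast
    have "y \<notin> nonzero_squares"
    proof
      assume "y \<in> nonzero_squares"
      then have "square_class y = nonzero_squares" using square_class_eq[of y 1] unfolding nonzero_squares_eq by blast
      moreover have "square_class y = c" using square_class_eq[of y x] x by blast
      ultimately show False using c(2) by simp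
    qed
    moreover have "y \<noteq> 0" using x by (auto simp: mem_square_class)
    ultimately show "y \<in> carrier mult_group - nonzero_squares" by (simp add: mult_group_def)
  next
    fix c assume c: "c \<in> carrier ((mult_group :: 'k monoid) Mod nonzero_squares) - {nonzero_squares}"
    show "\<exists>!\<delta>. \<delta> \<in> R \<inter> c"
    proof (rule ex1I)
      show "(SOME y. y \<in> c) \<in> R \<inter> c" using c some[of c] by (auto simp: R_def)
      fix d assume d: "d \<in> R \<inter> c"
      then obtain c' where c': "c' \<in> carrier ((mult_group :: 'k monoid) Mod nonzero_squares)"
        "d = (SOME y. y \<in> c')"
        by (auto simp: R_def)
      obtain x where x: "c = square_class x" using some[of c] c by blast
      obtain x' where x': "c' = square_class x'" "d \<in> c'" using some[OF c'(1)] c'(2) by blast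
      have "c = c'" using square_class_eq[of d x] square_class_eq[of d x'] d x x' by blast
      then show "d = (SOME y. y \<in> c)" using c'(2) by simp
    qed
  qed
  then show ?thesis ..
qed

text \<open>The matrices diag(t, 1), with t running through representatives of all square classes,
  serve for every \<delta>: up to a scalar factor each \<open>g\<close> in \<open>GL2\<close> is one
  of them times an element of \<open>SL2\<close>.\<close>

lemma conj_cover_exists:
  fixes \<delta> :: "'k::field"
  assumes "finite (carrier ((mult_group :: 'k monoid) Mod nonzero_squares))"
  shows "\<exists>N. conj_cover \<delta> N"
proof -
  define T where "T = (\<lambda>c. SOME y. y \<in> c) ` carrier ((mult_group :: 'k monoid) Mod nonzero_squares)"
  have T: "\<exists>t\<in>T. \<exists>s. s \<noteq> 0 \<and> t = s\<^sup>2 * x" if "x \<noteq> 0" for x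
  proof -
      have "square_class x \<in> carrier (mult_group Mod nonzero_squares)"
      unfolding carrier_Mod_nonzero_squares using that by blast
    then have "(SOME y. y \<in> square_class x) \<in> T" unfolding T_def by (rule imageI)
    moreover have "(SOME y. y \<in> square_class x) \<in> square_class x"
      using square_class_self by (rule someI[of "\<lambda>y. y \<in> square_class x"])
    ultimately show ?thesis unfolding mem_square_class by blast
  qed
  define N where "N = (\<lambda>t. mat2 t 0 0 1) ` (T - {0})"
  have N: "finite N" "N \<subseteq> carrier GL2" using assms by (auto simp: N_def T_def)
  have "\<exists>\<mu>\<in>N. \<exists>h\<in>carrier SL2. conj_set GL2 (Q \<delta>) g = conj_set GL2 (Q \<delta>) (\<mu> \<otimes>\<^bsub>GL2\<^esub> h)"
    if g: "g \<in> carrier GL2" for g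
  proof -
    have dg: "det g \<noteq> 0" using g by simp
    then obtain t s where ts: "t \<in> T" "s \<noteq> 0" "t = s\<^sup>2 * det g" using T by blast
    have t0: "t \<noteq> 0" using ts dg by simp
    \<comment> \<open>The scalar \<open>s\<close> turns det g into the representative
      \<open>t\<close>, so removing diag(t, 1) leaves determinant 1.\<close>
    define h where "h = mat2 (inverse t) 0 0 1 ** (mat s ** g)"
    have "det h = 1" using ts dg by (simp add: h_def det_mul det_mat field_simps)
    moreover have "mat2 t 0 0 1 ** h = mat s ** g"
    proof -
      have "mat2 t 0 0 1 ** h = (mat2 t 0 0 1 ** mat2 (inverse t) 0 0 1) ** (mat s ** g)"
        by (simp only: h_def matrix_mul_assoc)
      also have "mat2 t 0 0 1 ** mat2 (inverse t) 0 0 1 = mat 1" using t0 by (simp add: mat_eq_mat2)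
      finally show ?thesis by simp
    qed
    moreover have "mat2 t 0 0 1 \<in> N" using ts(1) t0 by (simp add: N_def)
    ultimately show ?thesis
      using conj_set_smult[OF g ts(2)] by (intro bexI[of _ "mat2 t 0 0 1"] bexI[of _ h]) simp_all
  qed
  note cover = this
  have "(\<Union>g\<in>carrier GL2. conj_set GL2 (Q \<delta>) g) =
      (\<Union>\<mu>\<in>N. \<Union>g\<in>carrier SL2. conj_set GL2 (Q \<delta>) (\<mu> \<otimes>\<^bsub>GL2\<^esub> g))"
  proof (intro subset_antisym UN_least)
    fix g assume "g \<in> carrier (GL2 :: ('k^2^2) monoid)"
    then obtain \<mu> h where h: "\<mu> \<in> N" "h \<in> carrier SL2"
      "conj_set GL2 (Q \<delta>) g = conj_set GL2 (Q \<delta>) (\<mu> \<otimes>\<^bsub>GL2\<^esub> h)"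
      using cover by blast
    show "conj_set GL2 (Q \<delta>) g \<subseteq>
        (\<Union>\<mu>\<in>N. \<Union>g\<in>carrier SL2. conj_set GL2 (Q \<delta>) (\<mu> \<otimes>\<^bsub>GL2\<^esub> g))"
      unfolding h(3) by (rule SUP_upper2[OF h(1)]) (rule UN_upper[OF h(2)])
  next
    fix \<mu> h :: "'k^2^2" assume "\<mu> \<in> N" "h \<in> carrier SL2"
    then have "\<mu> \<otimes>\<^bsub>GL2\<^esub> h \<in> carrier GL2" using N(2) by (auto simp: det_mul)
    then show "conj_set GL2 (Q \<delta>) (\<mu> \<otimes>\<^bsub>GL2\<^esub> h) \<subseteq> (\<Union>g\<in>carrier GL2. conj_set GL2 (Q \<delta>) g)"
      by (rule UN_upper)
  qed
  with N show ?thesis unfolding conj_cover_def by blast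
qed

text \<open>A cover \<open>M \<delta>\<close> only controls a union of matrices, not which subgroups
  occur. One non-scalar element suffices to recover the subgroup, because two of these tori sharing
  such an element are equal.\<close>

lemma cartan_subgroup_SL2_cases:
  fixes C :: "('k::field^2^2) set"
  assumes inf: "infinite (UNIV :: 'k set)" and two: "(2::'k) \<noteq> 0"
    and R: "nonsquare_reps R" and M: "\<And>\<delta>. \<delta> \<in> R \<Longrightarrow> conj_cover \<delta> (M \<delta>)"
    and C: "cartan_subgroup SL2 C"
  shows "(\<exists>g \<in> carrier SL2. C = conj_set SL2 Q1 g) \<or>
    (\<exists>\<delta>\<in>R. \<exists>\<mu>\<in>M \<delta>. \<exists>g \<in> carrier SL2. C = conj_set SL2 (conj_set GL2 (Q \<delta>) \<mu>) g)"
proof -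
  interpret group "GL2 :: ('k^2^2) monoid" by (rule group_GL2)
  obtain z where z: "trace z = 0" "det z \<noteq> 0" "C = mat_centralizer z"
    using cartan_subgroup_SL2_obtain[OF inf two C] by blast
  show ?thesis
  proof (cases "- det z \<in> nonzero_squares")
    case True
    then obtain c where "c \<noteq> 0" "- det z = c\<^sup>2" by (auto simp: nonzero_squares_def mult_group_def)
    then obtain g where "g \<in> carrier SL2" "mat_centralizer z = conj_set SL2 Q1 g"
      using mat_centralizer_split_conj_Q1[OF two z(1)] by metis
    then show ?thesis using z(3) by blast
  next
    case False
    then obtain s where s: "s \<noteq> 0" "s\<^sup>2 * (- det z) \<in> R"
      using nonsquare_reps_obtain[OF R, of "- det z"] z(2) by auto
    define \<delta> where "\<delta> = s\<^sup>2 * (- det z)"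
    define y where "y = mat s ** z"
    have Cy: "C = mat_centralizer y" using mat_centralizer_smult[OF s(1)] z(3) by (simp add: y_def)
    have tr: "trace y = 0"
    proof -
      obtain p q r where "z = mat2 p q r (- p)" using z(1) by (rule traceless_form)
      then show ?thesis by (simp add: y_def mat_eq_mat2)
    qed
    have dy: "- det y = \<delta>" "det y \<noteq> 0" using s(1) z(2) by (simp_all add: y_def \<delta>_def det_mul det_mat)
    obtain g where g: "g \<in> carrier GL2" "C = conj_set GL2 (Q \<delta>) g"
      using mat_centralizer_conj_Q[OF two tr dy(2)] unfolding dy(1) Cy by metis
    have "infinite C" unfolding Cy using infinite_mat_centralizer[OF inf two tr dy(2)] .
    then have "\<not> C \<subseteq> {mat 1, - mat 1}" using finite_subset by auto
    then obtain x where x: "x \<in> C" "x \<notin> {mat 1, - mat 1}" by blast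
    then have xs: "x \<notin> range mat" using scalar_det_1[of x] by (auto simp: Cy mat_centralizer_def)
    have \<delta>: "\<delta> \<in> R" using s(2) by (simp add: \<delta>_def)
    \<comment> \<open>The covering equation is used for the single non-scalar element
      \<open>x\<close> of \<open>C\<close>.\<close>
    have "x \<in> (\<Union>g\<in>carrier GL2. conj_set GL2 (Q \<delta>) g)" using x(1) g by blast
    then obtain \<mu> h where h: "\<mu> \<in> M \<delta>" "h \<in> carrier SL2" "x \<in> conj_set GL2 (Q \<delta>) (\<mu> \<otimes>\<^bsub>GL2\<^esub> h)"
      using M[OF \<delta>] unfolding conj_cover_def by blast
    have \<mu>: "\<mu> \<in> carrier GL2" using M[OF \<delta>] h(1) unfolding conj_cover_def by blast
    have hG: "h \<in> carrier GL2" using h(2) by simp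
    define k where "k = \<mu> \<otimes>\<^bsub>GL2\<^esub> h"
    have k: "k \<in> carrier GL2" using \<mu> hG unfolding k_def by (rule m_closed)
    define w where "w = inv\<^bsub>GL2\<^esub> k ** mat2 0 1 \<delta> 0 ** k"
    have Qw: "conj_set GL2 (Q \<delta>) k = mat_centralizer w"
      unfolding w_def Q_eq_mat_centralizer by (rule conj_set_mat_centralizer[OF k])
    have "\<delta> \<noteq> 0" using dy by auto
    then have "trace w = 0" "det w \<noteq> 0"
      using traceless_conj[OF _ k, of "mat2 0 1 \<delta> 0"] by (simp_all add: w_def)
    then have wn: "w \<notin> range mat" using nonscalar_traceless two by blast
    have yn: "y \<notin> range mat" using nonscalar_traceless[OF tr dy(2) two] .
    have "x ** y = y ** x" "x ** w = w ** x"
      using x(1) h(3)[folded GL2_simps(1) k_def, unfolded Qw] by (simp_all add: Cy mat_centralizer_def)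
    \<comment> \<open>Both \<open>y\<close> and \<open>w\<close> commute with the non-scalar
      \<open>x\<close>, so all three have the same centraliser.\<close>
    then have "mat_centralizer y = mat_centralizer w"
      using mat_centralizer_eq[OF _ xs] yn wn by metis
    then have "C = conj_set GL2 (Q \<delta>) k" using Cy Qw by simp
    also have "\<dots> = conj_set GL2 (conj_set GL2 (Q \<delta>) \<mu>) h"
      unfolding k_def using conj_set_conj_set[OF _ \<mu> hG] mat_centralizer_subset_GL2
      by (metis Q_eq_mat_centralizer)
    also have "\<dots> = conj_set SL2 (conj_set GL2 (Q \<delta>) \<mu>) h" using conj_set_SL2[OF h(2)] by simp
    finally show ?thesis using \<delta> h by blast
  qed
qed

theorem theorem2p8:
  assumes "infinite (UNIV :: 'k::field set)"
    and "CHAR('k) \<noteq> 2"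
    and "finite (carrier ((mult_group :: 'k monoid) Mod nonzero_squares))"
  shows "cartan_subgroup SL2 (Q1 :: ('k^2^2) set) \<and>
    (\<forall>\<delta> \<in> carrier (mult_group :: 'k monoid) - nonzero_squares. \<forall>\<mu> \<in> carrier GL2.
       cartan_subgroup SL2 (conj_set GL2 (Q \<delta>) \<mu>)) \<and>
    (\<exists>R :: 'k set. nonsquare_reps R) \<and>
    (\<forall>R :: 'k set. nonsquare_reps R \<longrightarrow>
       finite R \<and>
       (\<forall>\<delta>\<in>R. \<exists>N. conj_cover \<delta> N) \<and>
       (\<forall>M :: 'k \<Rightarrow> ('k^2^2) set. (\<forall>\<delta>\<in>R. conj_cover \<delta> (M \<delta>)) \<longrightarrow>
          (\<forall>C. cartan_subgroup SL2 C \<longrightarrow>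
             (\<exists>g \<in> carrier SL2. C = conj_set SL2 Q1 g) \<or>
             (\<exists>\<delta>\<in>R. \<exists>\<mu>\<in>M \<delta>. \<exists>g \<in> carrier SL2.
                C = conj_set SL2 (conj_set GL2 (Q \<delta>) \<mu>) g)))) \<and>
    finite (conj_class SL2 ` {C :: ('k^2^2) set. cartan_subgroup SL2 C})"
proof -
  interpret group "SL2 :: ('k^2^2) monoid" by (rule group_SL2)
  \<comment> \<open>If 2 were 0, the characteristic would divide 2, and 1 is impossible in a
    field.\<close>
  have two: "(2::'k) \<noteq> 0"
  proof
    assume "(2::'k) = 0"
    then have "of_nat 2 = (0::'k)" by simp
    then have "CHAR('k) dvd 2" by (simp only: of_nat_eq_0_iff_char_dvd)
    then have "CHAR('k) \<le> 2" by (rule dvd_imp_le) simp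
    moreover have "CHAR('k) \<noteq> 0" using \<open>CHAR('k) dvd 2\<close> by (metis dvd_0_left zero_neq_numeral)
    moreover have "CHAR('k) \<noteq> 1" using of_nat_CHAR[where ?'a = 'k] by (metis of_nat_1 one_neq_zero)
    ultimately show False using assms(2) by linarith
  qed
  have Q1_cartan: "cartan_subgroup SL2 (Q1 :: ('k^2^2) set)"
    unfolding Q1_eq_mat_centralizer[OF two] using assms(1) two by (intro cartan_mat_centralizer) simp_all
  have Q_cartan: "cartan_subgroup SL2 (conj_set GL2 (Q \<delta>) \<mu>)"
    if "\<delta> \<in> carrier mult_group - nonzero_squares" "\<mu> \<in> carrier GL2" for \<delta> :: 'k and \<mu>
  proof -
    have "\<delta> \<noteq> 0" using that(1) by (simp add: mult_group_def)
    then show ?thesis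
      unfolding Q_eq_mat_centralizer conj_set_mat_centralizer[OF that(2)]
      using assms(1) two traceless_conj[OF _ that(2), of "mat2 0 1 \<delta> 0"]
      by (intro cartan_mat_centralizer) simp_all
  qed
  obtain R :: "'k set" where R: "nonsquare_reps R" using nonsquare_reps_exists by blast
  obtain M where M: "\<And>\<delta> :: 'k. conj_cover \<delta> (M \<delta>)"
    using conj_cover_exists[OF assms(3)] by metis
  \<comment> \<open>For one fixed choice of \<open>R\<close> and \<open>M\<close>, every conjugacy
    class occurs in an explicit finite list.\<close>
  have "conj_class SL2 ` {C :: ('k^2^2) set. cartan_subgroup SL2 C} \<subseteq>
      insert (conj_class SL2 Q1) (\<Union>\<delta>\<in>R. (\<lambda>\<mu>. conj_class SL2 (conj_set GL2 (Q \<delta>) \<mu>)) ` M \<delta>)"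
  proof (intro subsetI, elim imageE CollectE)
    fix c C assume c: "c = conj_class SL2 C" and C: "cartan_subgroup SL2 (C :: ('k^2^2) set)"
    have Q1_sub: "Q1 \<subseteq> carrier (SL2 :: ('k^2^2) monoid)"
      unfolding Q1_eq_mat_centralizer[OF two] by (rule mat_centralizer_subset_SL2)
    have Q_sub: "conj_set GL2 (Q \<delta>) \<mu> \<subseteq> carrier SL2" if "\<mu> \<in> M \<delta>" for \<delta> \<mu>
    proof -
      have "\<mu> \<in> carrier GL2" using M that unfolding conj_cover_def by blast
      from conj_set_mat_centralizer[OF this] show ?thesis
        unfolding Q_eq_mat_centralizer using mat_centralizer_subset_SL2 by metis
    qed
    from cartan_subgroup_SL2_cases[OF assms(1) two R M C]
    show "c \<in> insert (conj_class SL2 Q1) (\<Union>\<delta>\<in>R. (\<lambda>\<mu>. conj_class SL2 (conj_set GL2 (Q \<delta>) \<mu>)) ` M \<delta>)"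
    proof (elim disjE bexE)
      fix g assume "g \<in> carrier SL2" "C = conj_set SL2 Q1 g"
      then show ?thesis using conj_class_conj_set[OF Q1_sub] c by simp
    next
      fix \<delta> \<mu> g
      assume "\<delta> \<in> R" "\<mu> \<in> M \<delta>" "g \<in> carrier SL2" "C = conj_set SL2 (conj_set GL2 (Q \<delta>) \<mu>) g"
      then show ?thesis using conj_class_conj_set[OF Q_sub] c by blast
    qed
  qed
  moreover have "finite (insert (conj_class SL2 Q1) (\<Union>\<delta>\<in>R. (\<lambda>\<mu>. conj_class SL2 (conj_set GL2 (Q \<delta>) \<mu>)) ` M \<delta>))"
    using nonsquare_reps_finite[OF R assms(3)] M by (simp add: conj_cover_def)
  ultimately have fin: "finite (conj_class SL2 ` {C :: ('k^2^2) set. cartan_subgroup SL2 C})"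
    by (rule finite_subset)
  show ?thesis
  proof (intro conjI allI impI ballI)
    fix R :: "'k set" assume R: "nonsquare_reps R"
    show "finite R" using R assms(3) by (rule nonsquare_reps_finite)
    show "\<exists>N. conj_cover \<delta> N" for \<delta> :: 'k using assms(3) by (rule conj_cover_exists)
    fix M C assume "\<forall>\<delta>\<in>R. conj_cover \<delta> (M \<delta>)" "cartan_subgroup SL2 (C :: ('k^2^2) set)"
    then show "(\<exists>g \<in> carrier SL2. C = conj_set SL2 Q1 g) \<or>
        (\<exists>\<delta>\<in>R. \<exists>\<mu>\<in>M \<delta>. \<exists>g \<in> carrier SL2. C = conj_set SL2 (conj_set GL2 (Q \<delta>) \<mu>) g)"
      using cartan_subgroup_SL2_cases[OF assms(1) two R] by blast
  qed (use Q1_cartan Q_cartan nonsquare_reps_exists fin in simp_all)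
qed

end
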